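(* Let $\mathcal{R}$ be an amenable $\mathrm{II}_1$-relation. For every coefficient $\mathcal{R}$-module $E$ endowed with the trivial action, $\mathrm{H}^k_{mb}(\mathcal{R},E)=0$ for every $k\ge1$.
   Context: **$\mathrm{II}_1$-relations.** In this paper a $\mathrm{II}_1$-relation is a standard equivalence relation $\mathcal{R}\subset X\times X$ (i.e. a Borel subset of $X\times X$) with countable classes which is the orbit equivalence relation of a measure class preserving, ergodic action of a countable group on a non-atomic standard Borel probability space $(X,\mu)$. It is regarded as a groupoid with unit space $X$, product $(x,y)(y,z)=(x,z)$, inverse $(x,y)^{-1}=(y,x)$, target $t(x,y)=x$, source $s(x,y)=y$, and with the measure class of $V\mapsto\int_X|V\cap t^{-1}(x)|\,d\mu(x)$. Write $\mathcal{G}=\mathcal{R}$ and let $\nu$ be a symmetric probability measure in this class with disintegration $\nu=\int\nu^x\,d\mu'(x)$ along $t$ ($\mu'=t_*\nu$). **Amenability.** $\mathcal{G}$ is amenable if there is a family of means (positive linear functionals with $\mathfrak{m}^x(1)=1$) $\mathfrak{m}^x:L^\infty(\mathcal{G},\nu^x)\to\mathbb{R}$, $x\in X$, such that for every $\lambda\in L^\infty(\mathcal{G})$, with $\lambda^x$ the restriction of $\lambda$ to $t^{-1}(x)$ extended by zero, $x\mapsto\mathfrak{m}^x(\lambda^x)$ is Borel measurable, and for $\nu$-a.e. $g$ one has $\mathfrak{m}^{t(g)}(\lambda^{t(g)})=\mathfrak{m}^{s(g)}(g^{-1}\lambda^{t(g)})$ for all $\lambda$, where $(g^{-1}\lambda^{t(g)})(h)=\lambda(gh)$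 if $t(h)=s(g)$ and $0$ otherwise. **Measurable bounded cohomology (trivial action).** $E$ is the dual of a separable Banach space, with trivial action. $\mathcal{G}^{(n)}$ is the set of $n$-tuples in $\mathcal{G}$ with common target, with measure $\nu^{(n)}=\int(\nu^x)^{\otimes n}d\mu'(x)$. $L^\infty_{w^*}(\mathcal{G}^{(n)},E)$: weak$^*$ measurable essentially bounded functions modulo a.e. equality; $\lambda$ is $\mathcal{G}$-invariant if $\lambda(g^{-1}g_1,\dots,g^{-1}g_n)=\lambda(g_1,\dots,g_n)$ for $\nu^{(n+1)}$-a.e. $(g,g_1,\dots,g_n)\in\mathcal{G}^{(n+1)}$. $\mathrm{H}^k_{mb}(\mathcal{G},E)$ is the $k$-th cohomology of $\big(L^\infty_{w^*}(\mathcal{G}^{(k+1)},E)^{\mathcal{G}}\big)_{k\ge0}$ with the homogeneous coboundary $\delta\lambda(g_1,\dots,g_{k+2})=\sum_i(-1)^{i-1}\lambda(\dots,\widehat{g_i},\dots)$. *)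

theory Defs
  imports
    "HOL-Probability.Probability"
    "HOL-Algebra.Group_Action"
    "HOL-Algebra.Elementary_Groups"
begin

section \<open>Type II1 relations\<close>

definition standard_borel_space :: "'a measure \<Rightarrow> bool" where
  "standard_borel_space M \<longleftrightarrow>
     (\<exists>T. completely_metrizable_space T \<and> second_countable T \<and> topspace T = space M \<and>
          sets M = sigma_sets (space M) {U. openin T U})"

definition nonatomic :: "'a measure \<Rightarrow> bool" where
  "nonatomic M \<longleftrightarrow>
     (\<forall>A\<in>sets M. 0 < emeasure M A \<longrightarrow>
        (\<exists>B\<in>sets M. B \<subseteq> A \<and> 0 < emeasure M B \<and> emeasure M B < emeasure M A))"

definition class_preserving_action ::
    "('g, 'm) monoid_scheme \<Rightarrow> 'a measure \<Rightarrow> ('g \<Rightarrow> 'a \<Rightarrow> 'a) \<Rightarrow> bool" where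
  "class_preserving_action G M \<phi> \<longleftrightarrow>
     group_action G (space M) \<phi> \<and>
     (\<forall>g\<in>carrier G. \<phi> g \<in> measurable M M \<and> null_sets (distr M M (\<phi> g)) = null_sets M)"

definition ergodic_action ::
    "('g, 'm) monoid_scheme \<Rightarrow> 'a measure \<Rightarrow> ('g \<Rightarrow> 'a \<Rightarrow> 'a) \<Rightarrow> bool" where
  "ergodic_action G M \<phi> \<longleftrightarrow>
     (\<forall>A\<in>sets M. (\<forall>g\<in>carrier G. \<phi> g ` A = A) \<longrightarrow>
        emeasure M A = 0 \<or> emeasure M (space M - A) = 0)"

text \<open>Every countable group is isomorphic to one whose carrier is a set of natural numbers, so it
  suffices to let the acting group range over the groups with elements of type \<^typ>\<open>nat\<close>.\<close>

definition II1_relation :: "'a measure \<Rightarrow> ('a \<times> 'a) set \<Rightarrow> bool" where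
  "II1_relation M R \<longleftrightarrow>
     prob_space M \<and> standard_borel_space M \<and> nonatomic M \<and>
     R \<in> sets (M \<Otimes>\<^sub>M M) \<and> equiv (space M) R \<and> (\<forall>x\<in>space M. countable (R `` {x})) \<and>
     (\<exists>(G::nat monoid) \<phi>. group G \<and> class_preserving_action G M \<phi> \<and> ergodic_action G M \<phi> \<and>
        R = {(x, y). x \<in> space M \<and> y \<in> orbit G \<phi> x})"


section \<open>The measured groupoid of a relation\<close>

text \<open>Target and source are \<^const>\<open>fst\<close> and \<^const>\<open>snd\<close>; the product \<open>gmult g h\<close> is only meaningful
  if \<open>snd g = fst h\<close>.\<close>

definition gmult :: "'a \<times> 'a \<Rightarrow> 'a \<times> 'a \<Rightarrow> 'a \<times> 'a" where
  "gmult g h = (fst g, snd h)"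

definition ginv :: "'a \<times> 'a \<Rightarrow> 'a \<times> 'a" where
  "ginv g = (snd g, fst g)"

text \<open>Only the Borel structure of the following measure space is ever used.\<close>

definition rel_space :: "'a measure \<Rightarrow> ('a \<times> 'a) set \<Rightarrow> ('a \<times> 'a) measure" where
  "rel_space M R = restrict_space (M \<Otimes>\<^sub>M M) R"

text \<open>A symmetric probability measure in the measure class of
  \<open>V \<mapsto> \<integral> card (V \<inter> fst -` {x}) d\<mu>(x)\<close>, where two measures are in the same class if they have the
  same null sets.\<close>

definition symmetric_class_prob ::
    "'a measure \<Rightarrow> ('a \<times> 'a) set \<Rightarrow> ('a \<times> 'a) measure \<Rightarrow> bool" where
  "symmetric_class_prob M R \<nu> \<longleftrightarrow>
     prob_space \<nu> \<and> sets \<nu> = sets (rel_space M R) \<and>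
     (\<forall>V\<in>sets \<nu>. emeasure \<nu> V = 0 \<longleftrightarrow>
        (\<integral>\<^sup>+x. emeasure (count_space UNIV) (V \<inter> fst -` {x}) \<partial>M) = 0) \<and>
     distr \<nu> \<nu> ginv = \<nu>"

definition target_disintegration ::
    "'a measure \<Rightarrow> ('a \<times> 'a) set \<Rightarrow> ('a \<times> 'a) measure \<Rightarrow> ('a \<Rightarrow> ('a \<times> 'a) measure) \<Rightarrow> bool" where
  "target_disintegration M R \<nu> \<kappa> \<longleftrightarrow>
     \<kappa> \<in> measurable M (prob_algebra (rel_space M R)) \<and>
     (AE x in distr \<nu> M fst. AE g in \<kappa> x. fst g = x) \<and>
     \<nu> = distr \<nu> M fst \<bind> \<kappa>"


section \<open>Amenability\<close>

definition ess_bounded :: "'b measure \<Rightarrow> ('b \<Rightarrow> real) set" where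
  "ess_bounded L = {f \<in> borel_measurable L. \<exists>C. AE z in L. \<bar>f z\<bar> \<le> C}"

text \<open>A mean on the quotient of \<^term>\<open>ess_bounded L\<close> by almost everywhere equality, given as a
  functional on representatives.\<close>

definition is_mean :: "'b measure \<Rightarrow> (('b \<Rightarrow> real) \<Rightarrow> real) \<Rightarrow> bool" where
  "is_mean L m \<longleftrightarrow>
     (\<forall>f\<in>ess_bounded L. \<forall>g\<in>ess_bounded L. (AE z in L. f z = g z) \<longrightarrow> m f = m g) \<and>
     (\<forall>f\<in>ess_bounded L. \<forall>g\<in>ess_bounded L. m (\<lambda>z. f z + g z) = m f + m g) \<and>
     (\<forall>c. \<forall>f\<in>ess_bounded L. m (\<lambda>z. c * f z) = c * m f) \<and>
     (\<forall>f\<in>ess_bounded L. (AE z in L. 0 \<le> f z) \<longrightarrow> 0 \<le> m f) \<and>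
     m (\<lambda>_. 1) = 1"

text \<open>Every class of essentially bounded functions has a bounded Borel representative, whose
  restriction to each single fibre is again bounded.\<close>

definition bounded_borel :: "'b measure \<Rightarrow> ('b \<Rightarrow> real) set" where
  "bounded_borel L = {f \<in> borel_measurable L. \<exists>C. \<forall>z\<in>space L. \<bar>f z\<bar> \<le> C}"

definition fibre_restrict :: "'a \<Rightarrow> ('a \<times> 'a \<Rightarrow> real) \<Rightarrow> 'a \<times> 'a \<Rightarrow> real" where
  "fibre_restrict x f = (\<lambda>g. if fst g = x then f g else 0)"

definition inv_translate :: "'a \<times> 'a \<Rightarrow> ('a \<times> 'a \<Rightarrow> real) \<Rightarrow> 'a \<times> 'a \<Rightarrow> real" where
  "inv_translate g f = (\<lambda>h. if fst h = snd g then f (gmult g h) else 0)"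

text \<open>A class of functions modulo null sets determines the restrictions to the fibres, and hence
  their means, only up to a null set of base points. Measurability of \<open>x \<mapsto> m x (fibre_restrict x f)\<close>
  is accordingly required up to null sets: measurability for the completion is equivalent to almost
  everywhere equality with a Borel function, and also to Borel measurability for some representative
  of the class of \<open>f\<close>.\<close>

definition amenable ::
    "'a measure \<Rightarrow> ('a \<times> 'a) set \<Rightarrow> ('a \<times> 'a) measure \<Rightarrow> ('a \<Rightarrow> ('a \<times> 'a) measure) \<Rightarrow> bool" where
  "amenable M R \<nu> \<kappa> \<longleftrightarrow>
     (\<exists>m. (\<forall>x\<in>space M. is_mean (\<kappa> x) (m x)) \<and>
          (\<forall>f\<in>bounded_borel (rel_space M R).
             (\<lambda>x. m x (fibre_restrict x f)) \<in> borel_measurable (completion M)) \<and>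
          (AE g in \<nu>. \<forall>f\<in>bounded_borel (rel_space M R).
             m (fst g) (fibre_restrict (fst g) f) =
             m (snd g) (inv_translate g (fibre_restrict (fst g) f))))"


section \<open>Measurable bounded cohomology with trivial action\<close>

definition tuples :: "('a \<times> 'a) set \<Rightarrow> nat \<Rightarrow> (nat \<Rightarrow> 'a \<times> 'a) set" where
  "tuples R n = {f \<in> {..<n} \<rightarrow>\<^sub>E R. \<forall>i<n. \<forall>j<n. fst (f i) = fst (f j)}"

definition tuple_measure ::
    "'a measure \<Rightarrow> ('a \<times> 'a) set \<Rightarrow> ('a \<times> 'a) measure \<Rightarrow> ('a \<Rightarrow> ('a \<times> 'a) measure) \<Rightarrow>
     nat \<Rightarrow> (nat \<Rightarrow> 'a \<times> 'a) measure" where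
  "tuple_measure M R \<nu> \<kappa> n =
     restrict_space (distr \<nu> M fst \<bind> (\<lambda>x. PiM {..<n} (\<lambda>_. \<kappa> x))) (tuples R n)"

text \<open>The monadic bind is only meaningful for measurable kernels.\<close>

lemma measurable_PiM_kernel:
  assumes \<kappa>: "\<kappa> \<in> measurable M (prob_algebra N)"
  shows "(\<lambda>x. PiM {..<n::nat} (\<lambda>_. \<kappa> x)) \<in> measurable M (prob_algebra (PiM {..<n} (\<lambda>_. N)))"
proof (rule measurable_prob_algebra_generated[OF sets_PiM Int_stable_prod_algebra
      prod_algebra_sets_into_space])
  fix x assume "x \<in> space M"
  then have "\<kappa> x \<in> space (prob_algebra N)"
    using \<kappa> by (rule measurable_space[rotated])
  then have x: "prob_space (\<kappa> x)" "sets (\<kappa> x) = sets N"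
    by (auto simp: space_prob_algebra)
  show "prob_space (PiM {..<n} (\<lambda>_. \<kappa> x))"
    using x(1) by (intro prob_space_PiM)
  show "sets (PiM {..<n} (\<lambda>_. \<kappa> x)) = sets (PiM {..<n} (\<lambda>_. N))"
    using x(2) by (intro sets_PiM_cong) auto
next
  fix A assume "A \<in> prod_algebra {..<n} (\<lambda>_. N)"
  then obtain E where A: "A = Pi\<^sub>E {..<n} E" and E: "\<And>i. i < n \<Longrightarrow> E i \<in> sets N"
    by (auto elim!: prod_algebraE_all)
  have "emeasure (PiM {..<n} (\<lambda>_. \<kappa> x)) A = (\<Prod>i<n. emeasure (\<kappa> x) (E i))"
    if "x \<in> space M" for x
  proof -
    have "\<kappa> x \<in> space (prob_algebra N)"
      using \<kappa> that by (rule measurable_space)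
    then have x: "prob_space (\<kappa> x)" "sets (\<kappa> x) = sets N"
      by (auto simp: space_prob_algebra)
    interpret prob_space "\<kappa> x" by fact
    interpret product_sigma_finite "\<lambda>_::nat. \<kappa> x" by unfold_locales
    show ?thesis
      unfolding A using E x(2) by (intro emeasure_PiM) auto
  qed
  moreover have "(\<lambda>x. \<Prod>i<n. emeasure (\<kappa> x) (E i)) \<in> borel_measurable M"
    using E \<kappa> by (intro borel_measurable_prod_ennreal)
      (auto intro!: measurable_emeasure_kernel measurable_prob_algebraD)
  ultimately show "(\<lambda>x. emeasure (PiM {..<n} (\<lambda>_. \<kappa> x)) A) \<in> borel_measurable M"
    by (subst measurable_cong)
qed

text \<open>Weak* measurable essentially bounded functions with values in the dual of \<open>'e\<close>; they are
  representatives, to be identified if they agree almost everywhere.\<close>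

definition Linf_wstar ::
    "'b measure \<Rightarrow> ('b \<Rightarrow> ('e::real_normed_vector \<Rightarrow>\<^sub>L real)) set" where
  "Linf_wstar L =
     {a. (\<forall>v. (\<lambda>z. blinfun_apply (a z) v) \<in> borel_measurable L) \<and>
         (\<exists>C. AE z in L. norm (a z) \<le> C)}"

text \<open>Below, \<open>\<G> n\<close> stands for the space of \<open>n\<close>-tuples with its measure. A tuple
  \<open>(g, g\<^sub>1, \<dots>, g\<^sub>n)\<close> is a function on \<open>{..<Suc n}\<close> with \<open>g\<close> in position 0.\<close>

definition tail_tuple :: "nat \<Rightarrow> (nat \<Rightarrow> 'a \<times> 'a) \<Rightarrow> nat \<Rightarrow> 'a \<times> 'a" where
  "tail_tuple n f = (\<lambda>i\<in>{..<n}. f (Suc i))"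

definition translated_tail :: "nat \<Rightarrow> (nat \<Rightarrow> 'a \<times> 'a) \<Rightarrow> nat \<Rightarrow> 'a \<times> 'a" where
  "translated_tail n f = (\<lambda>i\<in>{..<n}. gmult (ginv (f 0)) (f (Suc i)))"

definition inv_cochains ::
    "(nat \<Rightarrow> (nat \<Rightarrow> 'a \<times> 'a) measure) \<Rightarrow> nat \<Rightarrow>
     ((nat \<Rightarrow> 'a \<times> 'a) \<Rightarrow> ('e::real_normed_vector \<Rightarrow>\<^sub>L real)) set" where
  "inv_cochains \<G> k =
     {a \<in> Linf_wstar (\<G> (Suc k)).
        AE f in \<G> (Suc (Suc k)). a (translated_tail (Suc k) f) = a (tail_tuple (Suc k) f)}"

definition omit :: "nat \<Rightarrow> nat \<Rightarrow> (nat \<Rightarrow> 'a \<times> 'a) \<Rightarrow> nat \<Rightarrow> 'a \<times> 'a" where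
  "omit n i f = (\<lambda>j\<in>{..<n}. f (if j < i then j else Suc j))"

definition coboundary ::
    "nat \<Rightarrow> ((nat \<Rightarrow> 'a \<times> 'a) \<Rightarrow> ('e::real_normed_vector \<Rightarrow>\<^sub>L real)) \<Rightarrow>
     (nat \<Rightarrow> 'a \<times> 'a) \<Rightarrow> ('e \<Rightarrow>\<^sub>L real)" where
  "coboundary k a f = (\<Sum>i<Suc (Suc k). (-1) ^ i *\<^sub>R a (omit (Suc k) i f))"

definition cocycles ::
    "(nat \<Rightarrow> (nat \<Rightarrow> 'a \<times> 'a) measure) \<Rightarrow> nat \<Rightarrow>
     ((nat \<Rightarrow> 'a \<times> 'a) \<Rightarrow> ('e::real_normed_vector \<Rightarrow>\<^sub>L real)) set" where
  "cocycles \<G> k = {a \<in> inv_cochains \<G> k. AE f in \<G> (Suc (Suc k)). coboundary k a f = 0}"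

text \<open>As representatives are used, the coboundaries include all functions that vanish almost
  everywhere; the quotient by them thus also performs the identification modulo null sets.\<close>

fun coboundaries ::
    "(nat \<Rightarrow> (nat \<Rightarrow> 'a \<times> 'a) measure) \<Rightarrow> nat \<Rightarrow>
     ((nat \<Rightarrow> 'a \<times> 'a) \<Rightarrow> ('e::real_normed_vector \<Rightarrow>\<^sub>L real)) set" where
  "coboundaries \<G> 0 = {a \<in> inv_cochains \<G> 0. AE f in \<G> 1. a f = 0}"
| "coboundaries \<G> (Suc k) =
     {a \<in> inv_cochains \<G> (Suc k).
        \<exists>b\<in>inv_cochains \<G> k. AE f in \<G> (Suc (Suc k)). a f = coboundary k b f}"

definition cocycle_group ::
    "(nat \<Rightarrow> (nat \<Rightarrow> 'a \<times> 'a) measure) \<Rightarrow> nat \<Rightarrow>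
     ((nat \<Rightarrow> 'a \<times> 'a) \<Rightarrow> ('e::real_normed_vector \<Rightarrow>\<^sub>L real)) monoid" where
  "cocycle_group \<G> k =
     \<lparr>carrier = cocycles \<G> k, monoid.mult = (\<lambda>a b f. a f + b f), one = (\<lambda>_. 0)\<rparr>"

definition Hmb ::
    "'a measure \<Rightarrow> ('a \<times> 'a) set \<Rightarrow> ('a \<times> 'a) measure \<Rightarrow> ('a \<Rightarrow> ('a \<times> 'a) measure) \<Rightarrow> nat \<Rightarrow>
     ((nat \<Rightarrow> 'a \<times> 'a) \<Rightarrow> ('e::real_normed_vector \<Rightarrow>\<^sub>L real)) set monoid" where
  "Hmb M R \<nu> \<kappa> k =
     cocycle_group (tuple_measure M R \<nu> \<kappa>) k Mod coboundaries (tuple_measure M R \<nu> \<kappa>) k"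

end

theory Submission
  imports Defs
begin

text \<open>A cocycle \<open>a\<close> of degree \<open>n \<ge> 1\<close> is the coboundary of its average over the first variable,
  \<open>b (g\<^sub>1, \<dots>, g\<^sub>n) v = m x (\<lambda>h. a (h, g\<^sub>1, \<dots>, g\<^sub>n) v)\<close>, where \<open>x\<close> is the common target and
  \<open>m x\<close> the mean given by amenability: apply \<open>m x\<close> to the cocycle identity at
  \<open>(h, g\<^sub>1, \<dots>, g\<^bsub>n+1\<^esub>)\<close>. Invariance of \<open>b\<close> comes from invariance of \<open>a\<close> and of the means. As the
  classes are countable and almost every fibre measure charges every point of its fibre, identities
  that hold for almost all tuples hold for all tuples over almost every \<open>x\<close>, so all computations
  are pointwise; separability of \<open>'e\<close> reduces the choice of a null set making \<open>b\<close> weak* measurable to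
  countably many vectors \<open>v\<close>.\<close>

section \<open>Measurability up to null sets\<close>

text \<open>Each \<open>F i\<close> agrees almost everywhere with a Borel function. As
  \<open>I\<close> is countable, all the exceptional sets, together with that of \<open>P\<close>,
  lie in a single Borel null set \<open>N\<close>.\<close>

lemma null_set_borel_versions:
  fixes F :: "'i \<Rightarrow> 'b \<Rightarrow> real"
  assumes "countable I" and "\<And>i. i \<in> I \<Longrightarrow> F i \<in> borel_measurable (completion M)"
    and "AE x in M. P x"
  obtains N where "N \<in> null_sets M" "\<And>x. x \<in> space M \<Longrightarrow> x \<notin> N \<Longrightarrow> P x"
    "\<And>i. i \<in> I \<Longrightarrow> (\<lambda>x. if x \<in> N then 0 else F i x) \<in> borel_measurable M"
proof -
  have "\<forall>i\<in>I. \<exists>g\<in>borel_measurable M. AE x in M. F i x = g x"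
    using assms(2) completion_ex_borel_measurable_real by blast
  then obtain G where G: "\<And>i. i \<in> I \<Longrightarrow> G i \<in> borel_measurable M"
      "\<And>i. i \<in> I \<Longrightarrow> AE x in M. F i x = G i x"
    by metis
  have "AE x in M. P x \<and> (\<forall>i\<in>I. F i x = G i x)"
    using assms(1,3) G(2) by (simp add: AE_ball_countable)
  then obtain N where N: "{x \<in> space M. \<not> (P x \<and> (\<forall>i\<in>I. F i x = G i x))} \<subseteq> N"
      "emeasure M N = 0" "N \<in> sets M"
    by (rule AE_E)
  show thesis
  proof
    show "N \<in> null_sets M"
      using N by auto
    show "P x" if "x \<in> space M" "x \<notin> N" for x
      using N(1) that by blast
    show "(\<lambda>x. if x \<in> N then 0 else F i x) \<in> borel_measurable M" if i: "i \<in> I" for i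
    proof -
      have [measurable]: "N \<in> sets M" "G i \<in> borel_measurable M"
        using N(3) G(1)[OF i] by auto
      have "(\<lambda>x. if x \<in> N then 0 else G i x) \<in> borel_measurable M"
        by measurable
      moreover have "F i x = G i x" if "x \<in> space M" "x \<notin> N" for x
        using N(1) i that by blast
      ultimately show ?thesis
        by (subst measurable_cong[where g = "\<lambda>x. if x \<in> N then 0 else G i x"]) auto
    qed
  qed
qed

text \<open>Every \<open>v\<close> is the limit of a sequence in \<open>D\<close>, and each
  \<open>b z\<close> is continuous, so \<open>b z v\<close> is a pointwise limit of measurable
  functions.\<close>

lemma blinfun_measurable_dense:
  fixes b :: "'b \<Rightarrow> ('e::real_normed_vector \<Rightarrow>\<^sub>L real)"
  assumes "\<And>X :: 'e set. open X \<Longrightarrow> X \<noteq> {} \<Longrightarrow> \<exists>d\<in>D. d \<in> X"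
    and "\<And>v. v \<in> D \<Longrightarrow> (\<lambda>z. b z v) \<in> borel_measurable L"
  shows "(\<lambda>z. b z v) \<in> borel_measurable L"
proof -
  have "v \<in> closure D"
    unfolding closure_iff_nhds_not_empty using assms(1) by (metis disjoint_iff empty_iff subsetD)
  then obtain u where u: "\<And>n. u n \<in> D" "u \<longlonglongrightarrow> v"
    unfolding closure_sequential by auto
  show ?thesis
  proof (rule borel_measurable_LIMSEQ_real)
    show "(\<lambda>n. b z (u n)) \<longlonglongrightarrow> b z v" for z
      by (intro tendsto_intros u(2))
    show "(\<lambda>z. b z (u n)) \<in> borel_measurable L" for n
      by (rule assms(2)) (rule u(1))
  qed
qed

section \<open>Essentially bounded functions and means\<close>

lemma ess_boundedI:
  assumes "f \<in> borel_measurable L" "AE z in L. \<bar>f z\<bar> \<le> C"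
  shows "f \<in> ess_bounded L"
  using assms by (auto simp: ess_bounded_def)

lemma ess_bounded_const [simp]: "(\<lambda>_. c) \<in> ess_bounded L"
  by (rule ess_boundedI[of _ _ "\<bar>c\<bar>"]) auto

lemma ess_bounded_add:
  assumes "f \<in> ess_bounded L" "g \<in> ess_bounded L"
  shows "(\<lambda>z. f z + g z) \<in> ess_bounded L"
proof -
  obtain C D where *: "AE z in L. \<bar>f z\<bar> \<le> C" "AE z in L. \<bar>g z\<bar> \<le> D"
    using assms by (auto simp: ess_bounded_def)
  have "AE z in L. \<bar>f z + g z\<bar> \<le> C + D"
    using * by eventually_elim linarith
  then show ?thesis
    using assms by (intro ess_boundedI[of _ _ "C + D"]) (auto simp: ess_bounded_def)
qed

lemma ess_bounded_cmult:
  assumes "f \<in> ess_bounded L"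
  shows "(\<lambda>z. c * f z) \<in> ess_bounded L"
proof -
  obtain C where *: "AE z in L. \<bar>f z\<bar> \<le> C"
    using assms by (auto simp: ess_bounded_def)
  have "AE z in L. \<bar>c * f z\<bar> \<le> \<bar>c\<bar> * C"
    using * by eventually_elim (simp add: abs_mult mult_left_mono)
  then show ?thesis
    using assms by (intro ess_boundedI[of _ _ "\<bar>c\<bar> * C"]) (auto simp: ess_bounded_def)
qed

lemma ess_bounded_sum:
  assumes "finite I" "\<And>i. i \<in> I \<Longrightarrow> f i \<in> ess_bounded L"
  shows "(\<lambda>z. \<Sum>i\<in>I. f i z) \<in> ess_bounded L"
  using assms by (induction I rule: finite_induct) (auto intro: ess_bounded_add)

context
  fixes L :: "'b measure" and m
  assumes mean: "is_mean L m"
begin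

lemma mean_cong:
  "f \<in> ess_bounded L \<Longrightarrow> g \<in> ess_bounded L \<Longrightarrow> AE z in L. f z = g z \<Longrightarrow> m f = m g"
  using mean unfolding is_mean_def by blast

lemma mean_add:
  "f \<in> ess_bounded L \<Longrightarrow> g \<in> ess_bounded L \<Longrightarrow> m (\<lambda>z. f z + g z) = m f + m g"
  using mean unfolding is_mean_def by blast

lemma mean_cmult: "f \<in> ess_bounded L \<Longrightarrow> m (\<lambda>z. c * f z) = c * m f"
  using mean unfolding is_mean_def by blast

lemma mean_nonneg: "f \<in> ess_bounded L \<Longrightarrow> AE z in L. 0 \<le> f z \<Longrightarrow> 0 \<le> m f"
  using mean unfolding is_mean_def by blast

lemma mean_const: "m (\<lambda>_. c) = c"
proof -
  have "m (\<lambda>_. 1) = 1"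
    using mean unfolding is_mean_def by blast
  with mean_cmult[of "\<lambda>_. 1" c] show ?thesis
    by simp
qed

lemma mean_sum:
  assumes "finite I" "\<And>i. i \<in> I \<Longrightarrow> f i \<in> ess_bounded L"
  shows "m (\<lambda>z. \<Sum>i\<in>I. c i * f i z) = (\<Sum>i\<in>I. c i * m (f i))"
  using assms
proof (induction I rule: finite_induct)
  case (insert i I)
  then show ?case
    by (simp add: mean_add mean_cmult ess_bounded_cmult ess_bounded_sum)
qed (simp add: mean_const)

text \<open>Positivity of the mean, applied to both \<open>C + f\<close> and \<open>C - f\<close>,
  gives the two inequalities; the sign is the variable \<open>c\<close> in the proof.\<close>

lemma mean_abs_le:
  assumes f: "f \<in> ess_bounded L" and C: "AE z in L. \<bar>f z\<bar> \<le> C"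
  shows "\<bar>m f\<bar> \<le> C"
proof -
  have "0 \<le> m (\<lambda>z. C + c * f z)" if "\<bar>c\<bar> = 1" for c
  proof (rule mean_nonneg)
    show "AE z in L. 0 \<le> C + c * f z"
      using C
    proof eventually_elim
      case (elim z)
      then have "\<bar>c * f z\<bar> \<le> C"
        using that by (simp add: abs_mult)
      then show ?case
        by linarith
    qed
  qed (intro ess_bounded_add ess_bounded_cmult ess_bounded_const f)
  moreover have "m (\<lambda>z. C + c * f z) = C + c * m f" for c
    using f by (simp add: mean_add mean_const mean_cmult ess_bounded_cmult)
  ultimately have "0 \<le> C + c * m f" if "\<bar>c\<bar> = 1" for c
    using that by metis
  from this[of 1] this[of "- 1"] show ?thesis
    by simp
qed

end

section \<open>Face and translation identities for tuples\<close>

text \<open>The restriction to \<open>{..<Suc n}\<close> makes the result extensional, as points of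
  a product space \<open>PiM\<close> have to be.\<close>

definition cons_tuple :: "nat \<Rightarrow> 'b \<Rightarrow> (nat \<Rightarrow> 'b) \<Rightarrow> nat \<Rightarrow> 'b" where
  "cons_tuple n h f = (\<lambda>i\<in>{..<Suc n}. case i of 0 \<Rightarrow> h | Suc j \<Rightarrow> f j)"

lemma cons_tuple_0 [simp]: "cons_tuple n h f 0 = h"
  by (simp add: cons_tuple_def)

lemma cons_tuple_Suc [simp]: "i < n \<Longrightarrow> cons_tuple n h f (Suc i) = f i"
  by (simp add: cons_tuple_def)

lemma tail_cons_tuple: "f \<in> extensional {..<n} \<Longrightarrow> tail_tuple n (cons_tuple n h f) = f"
  by (rule extensionalityI[of _ "{..<n}"]) (auto simp: tail_tuple_def)

lemma omit_0_cons_tuple: "f \<in> extensional {..<n} \<Longrightarrow> omit n 0 (cons_tuple n h f) = f"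
  by (rule extensionalityI[of _ "{..<n}"]) (auto simp: omit_def)

text \<open>Together with \<open>omit_0_cons_tuple\<close> this describes the faces of a cone with
  apex \<open>h\<close>: the face opposite the apex is the base, every other face is the cone over a
  face of the base.\<close>

lemma omit_Suc_cons_tuple:
  assumes "i < Suc n"
  shows "omit (Suc n) (Suc i) (cons_tuple (Suc n) h f) = cons_tuple n h (omit n i f)"
proof (rule extensionalityI[of _ "{..<Suc n}"])
  fix j assume "j \<in> {..<Suc n}"
  then show "omit (Suc n) (Suc i) (cons_tuple (Suc n) h f) j = cons_tuple n h (omit n i f) j"
    by (cases j) (auto simp: omit_def)
qed (auto simp: omit_def cons_tuple_def)

text \<open>With \<open>g = f 0 = (x, y)\<close> one has
  \<open>gmult (ginv g) (x, w) = (y, w)\<close>. Prepending \<open>(y, w)\<close> after the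
  translation is thus the same as prepending \<open>(x, w)\<close> before it, which is the form in
  which invariance of a cochain applies.\<close>

lemma cons_translated_tail:
  assumes "fst (f 0) = x"
  shows "cons_tuple n (snd (f 0), w) (translated_tail n f) =
    translated_tail (Suc n) (cons_tuple (Suc n) (f 0) (cons_tuple n (x, w) (tail_tuple n f)))"
proof (rule extensionalityI[of _ "{..<Suc n}"])
  fix j assume "j \<in> {..<Suc n}"
  then show "cons_tuple n (snd (f 0), w) (translated_tail n f) j =
      translated_tail (Suc n) (cons_tuple (Suc n) (f 0) (cons_tuple n (x, w) (tail_tuple n f))) j"
    using assms by (cases j) (auto simp: translated_tail_def tail_tuple_def gmult_def ginv_def)
qed (auto simp: translated_tail_def cons_tuple_def)

section \<open>The diagonal of a standard Borel space\<close>

text \<open>A metrizable topology is T0, so a countable base \<open>B\<close> separates points.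
  Equality is then a conjunction of countably many Borel conditions
  \<open>fst p \<in> V \<longleftrightarrow> snd p \<in> V\<close>.\<close>

lemma standard_borel_space_diagonal:
  assumes "standard_borel_space M"
  shows "{p \<in> space (M \<Otimes>\<^sub>M M). fst p = snd p} \<in> sets (M \<Otimes>\<^sub>M M)"
proof -
  obtain T where T: "completely_metrizable_space T" "second_countable T" "topspace T = space M"
      "sets M = sigma_sets (space M) {U. openin T U}"
    using assms unfolding standard_borel_space_def by blast
  obtain B where B: "countable B" "\<forall>V\<in>B. openin T V"
      "\<forall>U x. openin T U \<and> x \<in> U \<longrightarrow> (\<exists>V\<in>B. x \<in> V \<and> V \<subseteq> U)"
    using T(2) unfolding second_countable_def by (elim exE conjE)
  have t0: "t0_space T"
    by (intro Hausdorff_imp_t0_space metrizable_imp_Hausdorff_space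
        completely_metrizable_imp_metrizable_space T(1))
  have BM: "V \<in> sets M" if "V \<in> B" for V
    using B(2) that T(4) by (auto intro: sigma_sets.Basic)
  have sep: "x = y \<longleftrightarrow> (\<forall>V\<in>B. x \<in> V \<longleftrightarrow> y \<in> V)" if "x \<in> space M" "y \<in> space M" for x y
  proof
    assume *: "\<forall>V\<in>B. x \<in> V \<longleftrightarrow> y \<in> V"
    show "x = y"
    proof (rule ccontr)
      assume "x \<noteq> y"
      then have "\<exists>U. openin T U \<and> (x \<notin> U) = (y \<in> U)"
        using t0 that unfolding t0_space_def T(3) by simp
      then obtain U where U: "openin T U" "(x \<notin> U) = (y \<in> U)"
        by blast
      have "z \<in> U \<Longrightarrow> \<exists>V\<in>B. z \<in> V \<and> V \<subseteq> U" for z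
        using B(3) U(1) by simp
      from this[of x] this[of y] U(2) * show False
        by auto
    qed
  qed auto
  have "{p \<in> space (M \<Otimes>\<^sub>M M). fst p = snd p} =
      {p \<in> space (M \<Otimes>\<^sub>M M). \<forall>V\<in>B. fst p \<in> V \<longleftrightarrow> snd p \<in> V}"
    using sep by (auto simp: space_pair_measure)
  also have "\<dots> \<in> sets (M \<Otimes>\<^sub>M M)"
    using B(1) BM by measurable
  finally show ?thesis .
qed

section \<open>Null sets and fibre measures of a countable relation\<close>

text \<open>The action enters through the Borel maps \<open>s n\<close>, whose graphs over
  \<open>space M\<close> fill \<open>R\<close>; they turn a statement about a whole class into
  countably many statements about its base point.\<close>

locale countable_measured_relation = prob_space M
  for M :: "'a measure" and R :: "('a \<times> 'a) set" and \<nu> :: "('a \<times> 'a) measure"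
    and \<kappa> :: "'a \<Rightarrow> ('a \<times> 'a) measure" and s :: "nat \<Rightarrow> 'a \<Rightarrow> 'a" +
  assumes diagonal: "{p \<in> space (M \<Otimes>\<^sub>M M). fst p = snd p} \<in> sets (M \<Otimes>\<^sub>M M)"
    and sets_R: "R \<in> sets (M \<Otimes>\<^sub>M M)"
    and equiv_R: "equiv (space M) R"
    and s_measurable [measurable]: "\<And>n. s n \<in> measurable M M"
    and R_iff: "\<And>x y. (x, y) \<in> R \<longleftrightarrow> x \<in> space M \<and> (\<exists>n. y = s n x)"
    and class_prob: "symmetric_class_prob M R \<nu>"
    and disintegration: "target_disintegration M R \<nu> \<kappa>"
begin

lemma R_sub: "(x, y) \<in> R \<Longrightarrow> x \<in> space M \<and> y \<in> space M"
  using equiv_R by (auto simp: equiv_def refl_on_def)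

lemma R_refl: "x \<in> space M \<Longrightarrow> (x, x) \<in> R"
  using equiv_R by (auto simp: equiv_def refl_on_def)

lemma R_sym: "(x, y) \<in> R \<Longrightarrow> (y, x) \<in> R"
  using equiv_R by (auto simp: equiv_def sym_def)

lemma R_trans: "(x, y) \<in> R \<Longrightarrow> (y, z) \<in> R \<Longrightarrow> (x, z) \<in> R"
  using equiv_R unfolding equiv_def trans_def by blast

lemma space_rel [simp]: "space (rel_space M R) = R"
  using sets.sets_into_space[OF sets_R] by (auto simp: rel_space_def space_restrict_space)

text \<open>The set in question is the preimage of the diagonal under the pair
  \<open>(f, g)\<close>. Measurability of points and of graphs in \<open>R\<close> rests on
  this.\<close>

lemma pred_eq [measurable (raw)]:
  assumes [measurable]: "f \<in> measurable N M" "g \<in> measurable N M"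
  shows "Measurable.pred N (\<lambda>z. f z = g z)"
proof -
  have "(\<lambda>z. (f z, g z)) -` {p \<in> space (M \<Otimes>\<^sub>M M). fst p = snd p} \<inter> space N \<in> sets N"
    by (rule measurable_sets[OF _ diagonal]) measurable
  also have "(\<lambda>z. (f z, g z)) -` {p \<in> space (M \<Otimes>\<^sub>M M). fst p = snd p} \<inter> space N =
      {z \<in> space N. f z = g z}"
    using assms[THEN measurable_space] by (auto simp: space_pair_measure)
  finally show ?thesis by simp
qed

lemma measurable_fst_rel [measurable]: "fst \<in> measurable (rel_space M R) M"
  unfolding rel_space_def by (intro measurable_restrict_space1) simp

lemma measurable_snd_rel [measurable]: "snd \<in> measurable (rel_space M R) M"
  unfolding rel_space_def by (intro measurable_restrict_space1) simp

lemma measurable_Pair_rel: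
  assumes "f \<in> measurable N M" "g \<in> measurable N M" "\<And>z. z \<in> space N \<Longrightarrow> (f z, g z) \<in> R"
  shows "(\<lambda>z. (f z, g z)) \<in> measurable N (rel_space M R)"
  unfolding rel_space_def using assms by (intro measurable_restrict_space2) auto

lemma singleton_sets: assumes "p \<in> R" shows "{p} \<in> sets (rel_space M R)"
proof -
  have "{q \<in> space (rel_space M R). fst q = fst p \<and> snd q = snd p} \<in> sets (rel_space M R)"
    using R_sub[of "fst p" "snd p"] assms unfolding pred_def[symmetric]
    by (intro pred_intros_logic pred_eq) auto
  also have "{q \<in> space (rel_space M R). fst q = fst p \<and> snd q = snd p} = {p}"
    using assms by (auto simp: prod_eq_iff)
  finally show ?thesis .
qed

lemma countable_fibre: "countable {g \<in> R. fst g = x}"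
proof -
  have "{g \<in> R. fst g = x} \<subseteq> range (\<lambda>n. (x, s n x))"
    using R_iff by auto
  then show ?thesis
    by (rule countable_subset) auto
qed

text \<open>Such a function differs from 0 only on one fibre, which is countable and whose points
  are measurable. Functions living on one fibre are therefore always Borel.\<close>

lemma measurable_fibre_function:
  fixes f :: "'a \<times> 'a \<Rightarrow> real"
  assumes "\<And>g. g \<in> R \<Longrightarrow> fst g \<noteq> x \<Longrightarrow> f g = 0"
  shows "f \<in> borel_measurable (rel_space M R)"
proof (rule measurable_discrete_difference[of "\<lambda>_. 0::real" _ _ "{g \<in> R. fst g = x}"])
  show "countable {g \<in> R. fst g = x}"
    by (rule countable_fibre)
qed (use assms singleton_sets in auto)

lemma sets_\<nu> [measurable_cong]: "sets \<nu> = sets (rel_space M R)"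
  using class_prob by (simp add: symmetric_class_prob_def)

lemma space_\<nu> [simp]: "space \<nu> = R"
  using sets_eq_imp_space_eq[OF sets_\<nu>] by simp

lemma null_\<nu>_iff:
  "V \<in> sets \<nu> \<Longrightarrow> emeasure \<nu> V = 0 \<longleftrightarrow>
     (\<integral>\<^sup>+x. emeasure (count_space UNIV) (V \<inter> fst -` {x}) \<partial>M) = 0"
  using class_prob by (simp add: symmetric_class_prob_def)

lemma distr_ginv: "distr \<nu> \<nu> ginv = \<nu>"
  using class_prob by (simp add: symmetric_class_prob_def)

lemma \<kappa>_kernel: "\<kappa> \<in> measurable M (prob_algebra (rel_space M R))"
  using disintegration by (simp add: target_disintegration_def)

lemma
  assumes "x \<in> space M"
  shows prob_\<kappa>: "prob_space (\<kappa> x)" and sets_\<kappa>: "sets (\<kappa> x) = sets (rel_space M R)"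
    and space_\<kappa>: "space (\<kappa> x) = R"
proof -
  have "\<kappa> x \<in> space (prob_algebra (rel_space M R))"
    using \<kappa>_kernel assms by (rule measurable_space)
  then show *: "prob_space (\<kappa> x)" "sets (\<kappa> x) = sets (rel_space M R)"
    by (auto simp: space_prob_algebra)
  show "space (\<kappa> x) = R"
    using sets_eq_imp_space_eq[OF *(2)] by simp
qed

text \<open>A \<nu>-null set \<open>V\<close> has fibre counts with integral zero. The count over
  \<open>x\<close> is at least 1 whenever \<open>(x, s n x) \<in> V\<close>, so this happens only
  for a null set of \<open>x\<close>; the countably many \<open>n\<close> exhaust the class of
  \<open>x\<close>.\<close>

lemma AE_target:
  assumes "AE g in \<nu>. Q g"
  shows "AE x in M. \<forall>y. (x, y) \<in> R \<longrightarrow> Q (x, y)"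
proof -
  obtain V where V: "{g \<in> R. \<not> Q g} \<subseteq> V" "emeasure \<nu> V = 0" "V \<in> sets \<nu>"
    using AE_E[OF assms, unfolded space_\<nu>] .
  have V' [measurable]: "V \<in> sets (rel_space M R)"
    using V(3) sets_\<nu> by simp
  have "AE x in M. (x, s n x) \<notin> V" for n
  proof -
    have [measurable]: "(\<lambda>x. (x, s n x)) \<in> measurable M (rel_space M R)"
      by (intro measurable_Pair_rel) (auto simp: R_iff)
    have A: "{x \<in> space M. (x, s n x) \<in> V} \<in> sets M"
      by measurable
    have "emeasure M {x \<in> space M. (x, s n x) \<in> V} =
        (\<integral>\<^sup>+x. indicator {x \<in> space M. (x, s n x) \<in> V} x \<partial>M)"
      using A by simp
    also have "\<dots> \<le> (\<integral>\<^sup>+x. emeasure (count_space UNIV) (V \<inter> fst -` {x}) \<partial>M)"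
    proof (intro nn_integral_mono)
      fix x
      show "indicator {x \<in> space M. (x, s n x) \<in> V} x \<le>
          emeasure (count_space UNIV) (V \<inter> fst -` {x})"
      proof (cases "(x, s n x) \<in> V")
        case True
        have "emeasure (count_space UNIV) {(x, s n x)} \<le>
            emeasure (count_space UNIV) (V \<inter> fst -` {x})"
          using True by (intro emeasure_mono) auto
        then show ?thesis
          by (auto simp: indicator_def)
      qed (auto simp: indicator_def)
    qed
    also have "\<dots> = 0"
      using null_\<nu>_iff[OF V(3)] V(2) by simp
    finally show ?thesis
      using A by (intro AE_I[of _ _ "{x \<in> space M. (x, s n x) \<in> V}"]) auto
  qed
  then have "AE x in M. \<forall>n. (x, s n x) \<notin> V"
    by (simp add: AE_all_countable)
  then show ?thesis
  proof eventually_elim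
    case (elim x)
    show ?case
    proof (intro allI impI)
      fix y assume xy: "(x, y) \<in> R"
      then obtain n where "y = s n x"
        by (auto simp: R_iff)
      with elim xy V(1) show "Q (x, y)"
        by blast
    qed
  qed
qed

text \<open>The target marginal has the same null sets as \<open>M\<close>. One direction reads off
  the unit \<open>(x, x)\<close> in the fibre over \<open>x\<close>; in the other, the preimage of a
  null set \<open>N\<close> has empty fibres off \<open>N\<close>.\<close>

lemma AE_target_marginal: "(AE x in distr \<nu> M fst. P x) \<longleftrightarrow> (AE x in M. P x)"
proof
  assume "AE x in distr \<nu> M fst. P x"
  then have "AE g in \<nu>. P (fst g)"
    by (rule AE_distrD[rotated]) measurable
  from AE_target[OF this] show "AE x in M. P x"
    using AE_space by eventually_elim (use R_refl in auto)
next
  assume "AE x in M. P x"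
  then obtain N where N: "{x \<in> space M. \<not> P x} \<subseteq> N" "emeasure M N = 0" "N \<in> sets M"
    by (elim AE_E)
  have m: "fst \<in> measurable \<nu> M"
    by measurable
  have "(\<integral>\<^sup>+x. emeasure (count_space UNIV) ((fst -` N \<inter> space \<nu>) \<inter> fst -` {x}) \<partial>M) =
      (\<integral>\<^sup>+x. 0 \<partial>M)"
  proof (rule nn_integral_cong_AE)
    have "AE x in M. x \<notin> N"
      using N by (intro AE_not_in) auto
    then show "AE x in M. emeasure (count_space UNIV) ((fst -` N \<inter> space \<nu>) \<inter> fst -` {x}) = 0"
    proof eventually_elim
      case (elim x)
      then have "(fst -` N \<inter> space \<nu>) \<inter> fst -` {x} = {}"
        by auto
      then show ?case
        by simp
    qed
  qed
  then have "emeasure \<nu> (fst -` N \<inter> space \<nu>) = 0"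
    using null_\<nu>_iff[OF measurable_sets[OF m N(3)]] by simp
  then have "emeasure (distr \<nu> M fst) N = 0"
    using m N(3) by (simp add: emeasure_distr)
  then show "AE x in distr \<nu> M fst. P x"
    using N by (intro AE_I[of _ _ N]) auto
qed

text \<open>The saturation of a null set is null: symmetry of \<nu> under \<open>ginv\<close>
  transfers a property of targets to sources.\<close>

lemma AE_class:
  assumes "AE x in M. P x"
  shows "AE x in M. \<forall>y. (x, y) \<in> R \<longrightarrow> P y"
proof -
  have "AE x in distr \<nu> M fst. P x"
    using assms AE_target_marginal by blast
  then have "AE g in \<nu>. P (fst g)"
    by (rule AE_distrD[rotated]) measurable
  then have "AE g in distr \<nu> \<nu> ginv. P (fst g)"
    by (simp only: distr_ginv)
  moreover have "ginv \<in> measurable \<nu> \<nu>"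
    unfolding ginv_def measurable_cong_sets[OF sets_\<nu> sets_\<nu>]
    by (rule measurable_Pair_rel) (auto intro: R_sym)
  ultimately have "AE g in \<nu>. P (fst (ginv g))"
    by (rule AE_distrD[rotated])
  from AE_target[OF this] show ?thesis
    by (simp add: ginv_def)
qed

lemma AE_\<kappa>_concentrated: "AE x in M. AE g in \<kappa> x. fst g = x"
  using disintegration AE_target_marginal[of "\<lambda>x. AE g in \<kappa> x. fst g = x"]
  by (simp add: target_disintegration_def)

lemma \<nu>_bind: "distr \<nu> M fst \<bind> \<kappa> = \<nu>"
  using disintegration by (simp add: target_disintegration_def)

lemma \<kappa>_subprob: "\<kappa> \<in> measurable (distr \<nu> M fst) (subprob_algebra (rel_space M R))"
  using measurable_prob_algebraD[OF \<kappa>_kernel] by simp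

text \<open>Let \<open>A\<close> be the set of base points whose fibre measure misses the graph
  \<open>\<Gamma>\<close> of \<open>s n\<close>. By disintegration the part of
  \<open>\<Gamma>\<close> over \<open>A\<close> is \<nu>-null. Since it has a point over each point
  of \<open>A\<close>, \<open>AE_target\<close> makes \<open>A\<close> null.\<close>

lemma AE_\<kappa>_atoms: "AE x in M. \<forall>y. (x, y) \<in> R \<longrightarrow> 0 < emeasure (\<kappa> x) {(x, y)}"
proof -
  have "AE x in M. 0 < emeasure (\<kappa> x) {(x, s n x)}" for n
  proof -
    define \<Gamma> where "\<Gamma> = {g \<in> space (rel_space M R). snd g = s n (fst g)}"
    have \<Gamma> [measurable]: "\<Gamma> \<in> sets (rel_space M R)"
      unfolding \<Gamma>_def by measurable
    define A where "A = {x \<in> space M. emeasure (\<kappa> x) \<Gamma> = 0}"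
    have [measurable]: "(\<lambda>x. emeasure (\<kappa> x) \<Gamma>) \<in> borel_measurable M"
      by (rule measurable_emeasure_kernel[OF measurable_prob_algebraD[OF \<kappa>_kernel]]) fact
    have A [measurable]: "A \<in> sets M"
      unfolding A_def by measurable
    have null: "AE x in M. AE g in \<kappa> x. \<not> (g \<in> \<Gamma> \<and> fst g \<in> A)"
      using AE_\<kappa>_concentrated AE_space
    proof eventually_elim
      case (elim x)
      have "AE g in \<kappa> x. x \<in> A \<longrightarrow> g \<notin> \<Gamma>"
        using elim(2) \<Gamma> by (cases "x \<in> A") (auto simp: A_def sets_\<kappa> intro!: AE_not_in)
      then show ?case
        using elim(1) by eventually_elim auto
    qed
    have "AE g in \<nu>. \<not> (g \<in> \<Gamma> \<and> fst g \<in> A)"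
      using null AE_target_marginal
        AE_bind[OF \<kappa>_subprob, of "\<lambda>g. \<not> (g \<in> \<Gamma> \<and> fst g \<in> A)"]
      unfolding \<nu>_bind by simp
    from AE_target[OF this] AE_\<kappa>_concentrated AE_space show ?thesis
    proof eventually_elim
      case (elim x)
      have "(x, s n x) \<in> \<Gamma>"
        using elim(3) by (auto simp: \<Gamma>_def R_iff)
      then have "x \<notin> A"
        using elim(1,3) R_iff by auto
      then have "0 < emeasure (\<kappa> x) \<Gamma>"
        using elim(3) by (simp add: A_def zero_less_iff_neq_zero)
      \<comment> \<open>As \<open>\<kappa> x\<close> is concentrated on the fibre over
        \<open>x\<close>, it sees only one point of the graph.\<close>
      also have "emeasure (\<kappa> x) \<Gamma> = emeasure (\<kappa> x) {(x, s n x)}"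
      proof (rule emeasure_eq_AE)
        show "AE g in \<kappa> x. g \<in> \<Gamma> \<longleftrightarrow> g \<in> {(x, s n x)}"
          using elim(2) AE_space
          by eventually_elim (use \<open>(x, s n x) \<in> \<Gamma>\<close> elim(3) in \<open>auto simp: \<Gamma>_def space_\<kappa>\<close>)
      qed (use \<Gamma> singleton_sets[of "(x, s n x)"] elim(3) in \<open>auto simp: sets_\<kappa> R_iff\<close>)
      finally show ?case .
    qed
  qed
  then have "AE x in M. \<forall>n. 0 < emeasure (\<kappa> x) {(x, s n x)}"
    by (simp add: AE_all_countable)
  then show ?thesis
    by eventually_elim (auto simp: R_iff)
qed


section \<open>Almost everywhere statements about tuples\<close>

abbreviation tuple_product :: "nat \<Rightarrow> (nat \<Rightarrow> 'a \<times> 'a) measure" where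
  "tuple_product n \<equiv> PiM {..<n} (\<lambda>_. rel_space M R)"

abbreviation \<G> :: "nat \<Rightarrow> (nat \<Rightarrow> 'a \<times> 'a) measure" where
  "\<G> \<equiv> tuple_measure M R \<nu> \<kappa>"

definition fibre_tuples :: "'a \<Rightarrow> nat \<Rightarrow> (nat \<Rightarrow> 'a \<times> 'a) set" where
  "fibre_tuples x n = {f \<in> {..<n} \<rightarrow>\<^sub>E R. \<forall>i<n. fst (f i) = x}"

lemma tuples_sets: "tuples R n \<in> sets (tuple_product n)"
proof -
  have [measurable]: "i \<in> {..<n} \<Longrightarrow> (\<lambda>f. fst (f i)) \<in> measurable (tuple_product n) M" for i
    by measurable
  have "tuples R n = {f \<in> space (tuple_product n). \<forall>i\<in>{..<n}. \<forall>j\<in>{..<n}. fst (f i) = fst (f j)}"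
    by (auto simp: tuples_def space_PiM)
  also have "\<dots> \<in> sets (tuple_product n)"
    by measurable
  finally show ?thesis .
qed

lemma PiM_kernel: "(\<lambda>x. PiM {..<n} (\<lambda>_. \<kappa> x)) \<in> measurable M (prob_algebra (tuple_product n))"
  by (rule measurable_PiM_kernel[OF \<kappa>_kernel])

lemma PiM_subprob:
  "(\<lambda>x. PiM {..<n} (\<lambda>_. \<kappa> x)) \<in> measurable (distr \<nu> M fst) (subprob_algebra (tuple_product n))"
  using measurable_prob_algebraD[OF PiM_kernel] by simp

lemma sets_PiM_\<kappa>: "x \<in> space M \<Longrightarrow> sets (PiM {..<n} (\<lambda>_. \<kappa> x)) = sets (tuple_product n)"
  by (intro sets_PiM_cong) (auto simp: sets_\<kappa>)

lemma sets_tuple_bind: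
  "sets (distr \<nu> M fst \<bind> (\<lambda>x. PiM {..<n} (\<lambda>_. \<kappa> x))) = sets (tuple_product n)"
  by (intro sets_bind) (auto simp: sets_PiM_\<kappa> not_empty)

lemma sets_\<G>: "sets (\<G> n) = sets (restrict_space (tuple_product n) (tuples R n))"
  unfolding tuple_measure_def by (intro sets_restrict_space_cong sets_tuple_bind)

lemma space_\<G>: "space (\<G> n) = tuples R n"
  using sets_eq_imp_space_eq[OF sets_\<G>[of n]] sets.sets_into_space[OF tuples_sets[of n]]
  by (auto simp: space_restrict_space)

lemma AE_\<G>_iff:
  "(AE f in \<G> n. P f) \<longleftrightarrow>
     (AE f in distr \<nu> M fst \<bind> (\<lambda>x. PiM {..<n} (\<lambda>_. \<kappa> x)). f \<in> tuples R n \<longrightarrow> P f)"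
  unfolding tuple_measure_def
proof (intro AE_restrict_space_iff sets.Int)
  show "tuples R n \<in> sets (distr \<nu> M fst \<bind> (\<lambda>x. PiM {..<n} (\<lambda>_. \<kappa> x)))"
    by (simp only: sets_tuple_bind tuples_sets)
qed (rule sets.top)

lemma tuples_eq: "n > 0 \<Longrightarrow> f \<in> tuples R n \<longleftrightarrow> f \<in> fibre_tuples (fst (f 0)) n"
  unfolding tuples_def fibre_tuples_def mem_Collect_eq by metis

lemma fibre_tuples_sub: "f \<in> fibre_tuples x n \<Longrightarrow> f \<in> tuples R n"
  unfolding tuples_def fibre_tuples_def by simp

text \<open>Almost every fibre measure charges every point of its fibre, so that null sets of tuples are
  empty over almost every base point.\<close>

lemma AE_fibre_tuplesD:
  assumes "AE f in \<G> n. P f"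
  shows "AE x in M. \<forall>f\<in>fibre_tuples x n. P f"
proof -
  let ?T = "distr \<nu> M fst \<bind> (\<lambda>x. PiM {..<n} (\<lambda>_. \<kappa> x))"
  have AE: "AE f in ?T. f \<in> tuples R n \<longrightarrow> P f"
    using assms AE_\<G>_iff by simp
  obtain V where V: "{f \<in> space ?T. \<not> (f \<in> tuples R n \<longrightarrow> P f)} \<subseteq> V" "emeasure ?T V = 0" "V \<in> sets ?T"
    using AE_E[OF AE] .
  have V' [measurable]: "V \<in> sets (tuple_product n)"
    using V(3) sets_tuple_bind by simp
  have "AE f in ?T. f \<notin> V"
    using V by (intro AE_not_in) auto
  then have "AE x in M. AE f in PiM {..<n} (\<lambda>_. \<kappa> x). f \<notin> V"
    using AE_bind[OF PiM_subprob, of "\<lambda>f. f \<notin> V"] AE_target_marginal by simp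
  from this AE_\<kappa>_atoms AE_space show ?thesis
  proof eventually_elim
    case (elim x)
    interpret K: prob_space "\<kappa> x"
      by (rule prob_\<kappa>) fact
    interpret product_sigma_finite "\<lambda>_::nat. \<kappa> x"
      by unfold_locales
    show ?case
    proof
      fix f assume f: "f \<in> fibre_tuples x n"
      have fR: "f i \<in> R" "f i = (x, snd (f i))" if "i < n" for i
        using f that by (auto simp: fibre_tuples_def prod_eq_iff)
      \<comment> \<open>A single tuple is a box with one-point sides, so its product measure is a
        finite product of masses of atoms, hence positive.\<close>
      have sing: "{f} = Pi\<^sub>E {..<n} (\<lambda>i. {f i})"
        using f by (subst PiE_singleton) (auto simp: fibre_tuples_def PiE_def)
      have "emeasure (PiM {..<n} (\<lambda>_. \<kappa> x)) {f} = (\<Prod>i<n. emeasure (\<kappa> x) {f i})"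
        unfolding sing using fR(1) elim(3)
        by (intro emeasure_PiM) (auto simp: sets_\<kappa> singleton_sets)
      moreover have "emeasure (\<kappa> x) {f i} \<noteq> 0" if "i < n" for i
        using elim(2) fR[OF that] by (metis less_irrefl)
      ultimately have pos: "emeasure (PiM {..<n} (\<lambda>_. \<kappa> x)) {f} \<noteq> 0"
        by (simp add: prod_zero_iff)
      have fs: "{f} \<in> sets (tuple_product n)"
        unfolding sing using fR(1) by (intro sets_PiM_I_finite) (auto simp: singleton_sets)
      have "f \<notin> V"
      proof
        assume "f \<in> V"
        have "AE h in PiM {..<n} (\<lambda>_. \<kappa> x). h \<notin> {f}"
          using elim(1) by eventually_elim (use \<open>f \<in> V\<close> in auto)
        then have "emeasure (PiM {..<n} (\<lambda>_. \<kappa> x)) {f} = 0"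
          using fs sets_PiM_\<kappa>[OF elim(3), of n]
          by (subst (asm) AE_iff_measurable[of "{f}"]) (auto dest: sets.sets_into_space)
        with pos show False ..
      qed
      moreover have "f \<in> space ?T"
        using fs sets.sets_into_space[of "{f}" ?T] by (simp add: sets_tuple_bind)
      ultimately show "P f"
        using V(1) fibre_tuples_sub[OF f] by blast
    qed
  qed
qed

text \<open>The product of the \<open>\<kappa> x\<close> is concentrated on tuples with base point
  \<open>x\<close>, so a null set of base points carries a null set of tuples. For
  \<open>n > 0\<close> the base point can be read off entry 0.\<close>

lemma AE_fibre_tuplesI:
  assumes "n > 0" and "AE x in M. \<forall>f\<in>fibre_tuples x n. P f"
  shows "AE f in \<G> n. P f"
proof -
  obtain N where N: "{x \<in> space M. \<not> (\<forall>f\<in>fibre_tuples x n. P f)} \<subseteq> N" "emeasure M N = 0" "N \<in> sets M"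
    using AE_E[OF assms(2)] .
  have [measurable]: "N \<in> sets M" "(\<lambda>f. fst (f 0)) \<in> measurable (tuple_product n) M"
    using N(3) assms(1) by auto
  have "AE x in M. x \<notin> N"
    using N by (intro AE_not_in) auto
  then have "AE x in M. AE f in PiM {..<n} (\<lambda>_. \<kappa> x). fst (f 0) \<notin> N"
    using AE_\<kappa>_concentrated AE_space
  proof eventually_elim
    case (elim x)
    have "AE f in PiM {..<n} (\<lambda>_. \<kappa> x). fst (f 0) = x"
      using elim(2,3) assms(1) by (intro AE_PiM_component) (auto simp: prob_\<kappa>)
    then show ?case
      by eventually_elim (use elim(1) in auto)
  qed
  then have "AE f in distr \<nu> M fst \<bind> (\<lambda>x. PiM {..<n} (\<lambda>_. \<kappa> x)). fst (f 0) \<notin> N"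
    using AE_bind[OF PiM_subprob, of "\<lambda>f. fst (f 0) \<notin> N"] AE_target_marginal by simp
  then show ?thesis
    unfolding AE_\<G>_iff
  proof eventually_elim
    case (elim f)
    show ?case
    proof
      assume "f \<in> tuples R n"
      then have f: "f \<in> fibre_tuples (fst (f 0)) n"
        using tuples_eq assms(1) by blast
      then have "f 0 \<in> R"
        using assms(1) by (auto simp: fibre_tuples_def)
      then have "fst (f 0) \<in> space M"
        using R_sub[of "fst (f 0)" "snd (f 0)"] by simp
      with elim f N(1) show "P f"
        by blast
    qed
  qed
qed

section \<open>Operations on tuples over a fixed base point\<close>

lemma fibre_tuples_extensional: "f \<in> fibre_tuples x n \<Longrightarrow> f \<in> extensional {..<n}"
  by (simp add: fibre_tuples_def PiE_def)

lemma fibre_tuplesI: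
  assumes "f \<in> extensional {..<n}" "\<And>i. i < n \<Longrightarrow> f i \<in> R" "\<And>i. i < n \<Longrightarrow> fst (f i) = x"
  shows "f \<in> fibre_tuples x n"
  using assms by (simp add: fibre_tuples_def PiE_iff)

lemma
  assumes "f \<in> fibre_tuples x n" "i < n"
  shows fibre_tuples_mem: "f i \<in> R" and fibre_tuples_fst: "fst (f i) = x"
  using assms by (simp_all add: fibre_tuples_def PiE_iff)

lemma cons_fibre_tuples:
  assumes "f \<in> fibre_tuples x n" "h \<in> R" "fst h = x"
  shows "cons_tuple n h f \<in> fibre_tuples x (Suc n)"
proof (rule fibre_tuplesI)
  show "cons_tuple n h f i \<in> R" if "i < Suc n" for i
    using assms that fibre_tuples_mem[OF assms(1)] by (cases i) auto
  show "fst (cons_tuple n h f i) = x" if "i < Suc n" for i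
    using assms that fibre_tuples_fst[OF assms(1)] by (cases i) auto
qed (simp add: cons_tuple_def)

lemma omit_fibre_tuples:
  assumes "f \<in> fibre_tuples x (Suc n)"
  shows "omit n i f \<in> fibre_tuples x n"
  using fibre_tuples_mem[OF assms] fibre_tuples_fst[OF assms]
  by (intro fibre_tuplesI) (simp_all add: omit_def)

lemma tail_fibre_tuples:
  assumes "f \<in> fibre_tuples x (Suc n)"
  shows "tail_tuple n f \<in> fibre_tuples x n"
  using fibre_tuples_mem[OF assms] fibre_tuples_fst[OF assms]
  by (intro fibre_tuplesI) (simp_all add: tail_tuple_def)

lemma R_of_fibre_tuples:
  assumes "f \<in> fibre_tuples x n" "i < n"
  shows "(x, snd (f i)) \<in> R"
  using fibre_tuples_mem[OF assms] fibre_tuples_fst[OF assms] by (metis prod.collapse)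

lemma translated_fibre_tuples:
  assumes "f \<in> fibre_tuples x (Suc n)"
  shows "translated_tail n f \<in> fibre_tuples (snd (f 0)) n"
proof (rule fibre_tuplesI)
  show "translated_tail n f i \<in> R" if "i < n" for i
    using R_trans[OF R_sym[OF R_of_fibre_tuples[OF assms, of 0]] R_of_fibre_tuples[OF assms, of "Suc i"]] that
    by (simp add: translated_tail_def gmult_def ginv_def)
qed (simp_all add: translated_tail_def gmult_def ginv_def)

section \<open>Slices of a cochain in its first variable\<close>

text \<open>Extension by zero off the fibre over \<open>x\<close> gives a function that is Borel by
  \<open>measurable_fibre_function\<close> and that \<open>fibre_restrict x\<close> leaves
  unchanged, so that it is a legitimate argument of the means.\<close>

definition slice ::
    "nat \<Rightarrow> ((nat \<Rightarrow> 'a \<times> 'a) \<Rightarrow> ('e::real_normed_vector \<Rightarrow>\<^sub>L real)) \<Rightarrow> 'a \<Rightarrow>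
     (nat \<Rightarrow> 'a \<times> 'a) \<Rightarrow> 'e \<Rightarrow> 'a \<times> 'a \<Rightarrow> real" where
  "slice n a x f v = (\<lambda>h. if h \<in> R \<and> fst h = x then a (cons_tuple n h f) v else 0)"

lemma slice_measurable: "slice n a x f v \<in> borel_measurable (rel_space M R)"
  by (rule measurable_fibre_function[of x]) (simp add: slice_def)

lemma slice_bound:
  assumes "\<And>f. f \<in> fibre_tuples x (Suc n) \<Longrightarrow> norm (a f) \<le> C" "0 \<le> C" "f \<in> fibre_tuples x n"
  shows "\<bar>slice n a x f v h\<bar> \<le> C * norm v"
proof (cases "h \<in> R \<and> fst h = x")
  case True
  then have "norm (a (cons_tuple n h f)) \<le> C"
    using assms(1,3) cons_fibre_tuples by blast
  then have "norm (blinfun_apply (a (cons_tuple n h f)) v) \<le> C * norm v"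
    by (meson norm_blinfun mult_right_mono norm_ge_zero order_trans)
  with True show ?thesis
    by (simp add: slice_def)
next
  case False
  then have "slice n a x f v h = 0"
    unfolding slice_def by (rule if_not_P)
  then show ?thesis
    using assms(2) by simp
qed

lemma slice_ess_bounded:
  assumes "\<And>f. f \<in> fibre_tuples x (Suc n) \<Longrightarrow> norm (a f) \<le> C" "0 \<le> C" "f \<in> fibre_tuples x n"
    and "z \<in> space M"
  shows "slice n a x f v \<in> ess_bounded (\<kappa> z)"
proof (rule ess_boundedI)
  show "slice n a x f v \<in> borel_measurable (\<kappa> z)"
    using slice_measurable by (simp add: measurable_cong_sets[OF sets_\<kappa>[OF assms(4)] refl])
  show "AE h in \<kappa> z. \<bar>slice n a x f v h\<bar> \<le> C * norm v"
    using slice_bound[OF assms(1-3)] by simp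
qed

lemma slice_add: "slice n a x f (v + w) = (\<lambda>h. slice n a x f v h + slice n a x f w h)"
  by (auto simp: slice_def blinfun.add_right)

lemma slice_scale: "slice n a x f (c *\<^sub>R v) = (\<lambda>h. c * slice n a x f v h)"
  by (auto simp: slice_def blinfun.scaleR_right)

section \<open>Countably many Borel families of tuples\<close>

text \<open>For fixed \<open>\<sigma>\<close> the tuple depends on the base point only; by
  \<open>ex_sections\<close> and \<open>eq_sections\<close>, all tuples over \<open>x\<close> arise
  as \<open>\<sigma>\<close> varies.\<close>

definition sections :: "nat \<Rightarrow> (nat \<Rightarrow> nat) \<Rightarrow> 'a \<Rightarrow> nat \<Rightarrow> 'a \<times> 'a" where
  "sections n \<sigma> x = (\<lambda>i\<in>{..<n}. (x, s (\<sigma> i) x))"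

lemma sections_fibre_tuples: "x \<in> space M \<Longrightarrow> sections n \<sigma> x \<in> fibre_tuples x n"
  by (intro fibre_tuplesI) (auto simp: sections_def R_iff)

lemma ex_sections:
  assumes "f \<in> fibre_tuples x n"
  shows "\<exists>\<sigma>\<in>{..<n} \<rightarrow>\<^sub>E UNIV. \<forall>i<n. snd (f i) = s (\<sigma> i) x"
proof -
  have "\<forall>i. \<exists>k. i < n \<longrightarrow> snd (f i) = s k x"
    using R_of_fibre_tuples[OF assms] R_iff by blast
  then obtain \<tau> where "\<And>i. i < n \<Longrightarrow> snd (f i) = s (\<tau> i) x"
    by metis
  then show ?thesis
    \<comment> \<open>Restricting the choice function puts it into
      \<open>{..<n} \<rightarrow>\<^sub>E UNIV\<close>, which is countable.\<close>
    by (intro bexI[of _ "restrict \<tau> {..<n}"]) auto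
qed

lemma eq_sections:
  assumes "f \<in> fibre_tuples x n" "\<And>i. i < n \<Longrightarrow> snd (f i) = s (\<sigma> i) x"
  shows "f = sections n \<sigma> x"
  using assms fibre_tuples_fst[OF assms(1)] fibre_tuples_extensional[OF assms(1)]
  by (intro extensionalityI[of _ "{..<n}"]) (simp_all add: sections_def prod_eq_iff)

lemma measurable_cons_sections:
  "(\<lambda>h. cons_tuple n h (sections n \<sigma> (fst h))) \<in> measurable (rel_space M R) (\<G> (Suc n))"
  unfolding measurable_cong_sets[OF refl sets_\<G>]
proof (rule measurable_restrict_space2)
  show "(\<lambda>h. cons_tuple n h (sections n \<sigma> (fst h))) \<in> space (rel_space M R) \<rightarrow> tuples R (Suc n)"
  proof
    fix h assume "h \<in> space (rel_space M R)"
    then have "h \<in> R" "fst h \<in> space M"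
      using R_sub[of "fst h" "snd h"] by simp_all
    then show "cons_tuple n h (sections n \<sigma> (fst h)) \<in> tuples R (Suc n)"
      using cons_fibre_tuples sections_fibre_tuples fibre_tuples_sub by blast
  qed
  show "(\<lambda>h. cons_tuple n h (sections n \<sigma> (fst h))) \<in> measurable (rel_space M R) (tuple_product (Suc n))"
    unfolding cons_tuple_def
  proof (rule measurable_restrict)
    fix i assume i: "i \<in> {..<Suc n}"
    show "(\<lambda>h. case i of 0 \<Rightarrow> h | Suc j \<Rightarrow> sections n \<sigma> (fst h) j) \<in>
        measurable (rel_space M R) (rel_space M R)"
    proof (cases i)
      case (Suc j)
      have "(\<lambda>h. (fst h, s (\<sigma> j) (fst h))) \<in> measurable (rel_space M R) (rel_space M R)"
      proof (rule measurable_Pair_rel)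
        show "(fst z, s (\<sigma> j) (fst z)) \<in> R" if "z \<in> space (rel_space M R)" for z
          using that R_sub[of "fst z" "snd z"] by (auto simp: R_iff)
      qed measurable
      with Suc i show ?thesis
        by (simp add: sections_def)
    qed simp
  qed
qed

end

section \<open>Averaging over an invariant family of means\<close>

locale amenable_measured_relation = countable_measured_relation +
  fixes m :: "'a \<Rightarrow> ('a \<times> 'a \<Rightarrow> real) \<Rightarrow> real"
  assumes mean: "\<And>x. x \<in> space M \<Longrightarrow> is_mean (\<kappa> x) (m x)"
    and mean_measurable: "\<And>f. f \<in> bounded_borel (rel_space M R) \<Longrightarrow>
      (\<lambda>x. m x (fibre_restrict x f)) \<in> borel_measurable (completion M)"
    and mean_invariant: "AE g in \<nu>. \<forall>f\<in>bounded_borel (rel_space M R).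
      m (fst g) (fibre_restrict (fst g) f) = m (snd g) (inv_translate g (fibre_restrict (fst g) f))"
begin

text \<open>Amenability controls \<open>x \<mapsto> m x (fibre_restrict x f)\<close> for one bounded
  Borel \<open>f\<close> on \<open>R\<close>. Along the section \<open>\<sigma>\<close> the slices
  over all base points fit together into such an \<open>f\<close>, which is set to 0 over
  \<open>N\<close> to make it bounded everywhere.\<close>

lemma slice_mean_measurable:
  fixes a :: "(nat \<Rightarrow> 'a \<times> 'a) \<Rightarrow> ('e::real_normed_vector \<Rightarrow>\<^sub>L real)"
  assumes a: "\<And>v. (\<lambda>f. a f v) \<in> borel_measurable (\<G> (Suc n))"
    and N: "N \<in> sets M"
    and C: "\<And>x f. x \<in> space M \<Longrightarrow> x \<notin> N \<Longrightarrow> f \<in> fibre_tuples x (Suc n) \<Longrightarrow> norm (a f) \<le> C" "0 \<le> C"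
  shows "(\<lambda>x. if x \<in> N then 0 else m x (slice n a x (sections n \<sigma> x) v)) \<in> borel_measurable (completion M)"
proof -
  define f where "f h = (if fst h \<in> N then 0 else a (cons_tuple n h (sections n \<sigma> (fst h))) v)" for h
  have eq: "f h = slice n a (fst h) (sections n \<sigma> (fst h)) v h" if "h \<in> R" "fst h \<notin> N" for h
    using that by (simp add: f_def slice_def)
  have bound: "\<bar>f h\<bar> \<le> C * norm v" if "h \<in> R" for h
  proof (cases "fst h \<in> N")
    case False
    have "fst h \<in> space M"
      using that R_sub[of "fst h" "snd h"] by simp
    then show ?thesis
      using slice_bound[OF C(1) C(2) sections_fibre_tuples, of "fst h"] False eq[OF that] by simp
  qed (use C(2) in \<open>simp add: f_def\<close>)
  have [measurable]: "(\<lambda>h. a (cons_tuple n h (sections n \<sigma> (fst h))) v) \<in> borel_measurable (rel_space M R)"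
    by (rule measurable_compose[OF measurable_cons_sections a])
  have fM [measurable]: "f \<in> borel_measurable (rel_space M R)"
    unfolding f_def using N by measurable
  have "f \<in> bounded_borel (rel_space M R)"
    using fM bound unfolding bounded_borel_def mem_Collect_eq space_rel by blast
  from mean_measurable[OF this]
  have "(\<lambda>x. m x (fibre_restrict x f)) \<in> borel_measurable (completion M)" .
  moreover have "(if x \<in> N then 0 else m x (slice n a x (sections n \<sigma> x) v)) = m x (fibre_restrict x f)"
    if x: "x \<in> space (completion M)" for x
  proof (cases "x \<in> N")
    case True
    then have "fibre_restrict x f = (\<lambda>_. 0)"
      by (auto simp: fibre_restrict_def f_def)
    with True x show ?thesis
      using mean_const[OF mean[of x], of 0] by simp
  next
    case False
    have xM: "x \<in> space M"
      using x by simp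
    have *: "slice n a x (sections n \<sigma> x) v \<in> ess_bounded (\<kappa> x)"
      using False xM by (intro slice_ess_bounded[OF C sections_fibre_tuples]) auto
    \<comment> \<open>Off \<open>R\<close> the two functions may differ, but the means see only
      \<open>R\<close>, the space of \<open>\<kappa> x\<close>.\<close>
    have eq': "fibre_restrict x f h = slice n a x (sections n \<sigma> x) v h" if "h \<in> R" for h
      using that eq[OF that] False by (auto simp: fibre_restrict_def slice_def)
    have "fibre_restrict x f \<in> borel_measurable (rel_space M R)"
      by (rule measurable_fibre_function[of x]) (simp add: fibre_restrict_def)
    then have "fibre_restrict x f \<in> ess_bounded (\<kappa> x)"
      using bound C(2) xM
      by (intro ess_boundedI[of _ _ "C * norm v"] AE_I2)
        (auto simp: measurable_cong_sets[OF sets_\<kappa>[OF xM] refl] space_\<kappa> fibre_restrict_def)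
    then have "m x (fibre_restrict x f) = m x (slice n a x (sections n \<sigma> x) v)"
      using * eq' xM by (intro mean_cong[OF mean[OF xM]] AE_I2) (auto simp: space_\<kappa>)
    with False show ?thesis
      by simp
  qed
  ultimately show ?thesis
    by (subst measurable_cong) auto
qed

text \<open>The value 0 over the exceptional set \<open>N\<close> keeps the average under control
  everywhere. Off \<open>N\<close> the argument of \<open>Blinfun\<close> is a bounded linear
  functional, as shown in the proof of \<open>average_apply\<close>.\<close>

definition average ::
    "nat \<Rightarrow> 'a set \<Rightarrow> ((nat \<Rightarrow> 'a \<times> 'a) \<Rightarrow> ('e::real_normed_vector \<Rightarrow>\<^sub>L real)) \<Rightarrow>
     (nat \<Rightarrow> 'a \<times> 'a) \<Rightarrow> ('e \<Rightarrow>\<^sub>L real)" where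
  "average n N a f =
     (if fst (f 0) \<in> N then 0 else Blinfun (\<lambda>v. m (fst (f 0)) (slice n a (fst (f 0)) f v)))"

context
  fixes n :: nat and N :: "'a set" and C :: real
    and a :: "(nat \<Rightarrow> 'a \<times> 'a) \<Rightarrow> ('e::{real_normed_vector, second_countable_topology} \<Rightarrow>\<^sub>L real)"
  assumes n: "0 < n" and C0: "0 \<le> C"
    and bounded: "\<forall>x\<in>space M - N. \<forall>f\<in>fibre_tuples x (Suc n). norm (a f) \<le> C"
begin

lemma bound: "x \<in> space M \<Longrightarrow> x \<notin> N \<Longrightarrow> f \<in> fibre_tuples x (Suc n) \<Longrightarrow> norm (a f) \<le> C"
  using bounded by blast

text \<open>Slices and means are linear, so the averaged functional is linear in \<open>v\<close>;
  by \<open>mean_abs_le\<close> a mean does not exceed a bound of its argument, so the bound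
  \<open>C\<close> of \<open>a\<close> survives.\<close>

lemma
  assumes x: "x \<in> space M" "x \<notin> N" and f: "f \<in> fibre_tuples x n"
  shows average_apply: "average n N a f v = m x (slice n a x f v)"
    and norm_average: "norm (average n N a f) \<le> C"
proof -
  have mx: "is_mean (\<kappa> x) (m x)"
    by (rule mean) fact
  have eb: "slice n a x f v \<in> ess_bounded (\<kappa> x)" for v
    using bound[OF x] C0 f x(1) by (rule slice_ess_bounded)
  have le: "\<bar>m x (slice n a x f v)\<bar> \<le> C * norm v" for v
    using slice_bound[OF bound[OF x] C0 f] by (intro mean_abs_le[OF mx eb]) simp
  have "bounded_linear (\<lambda>v. m x (slice n a x f v))"
  proof (rule bounded_linear_intro)
    show "norm (m x (slice n a x f v)) \<le> norm v * C" for v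
      using le[of v] by (simp add: mult.commute)
  qed (simp_all add: slice_add slice_scale mean_add[OF mx] mean_cmult[OF mx] eb)
  moreover have fx: "fst (f 0) = x"
    using f n by (rule fibre_tuples_fst)
  ultimately show *: "average n N a f v = m x (slice n a x f v)" for v
    using x(2) by (simp add: average_def bounded_linear_Blinfun_apply)
  show "norm (average n N a f) \<le> C"
    using C0 le by (intro norm_blinfun_bound) (simp_all add: *)
qed

text \<open>Amenability only gives measurability of means of functions on \<open>R\<close>. On the countably many Borel
  pieces where a tuple over \<open>x\<close> has the form \<open>(x, s (\<sigma> i) x)\<close>, the average depends on \<open>x\<close> alone.\<close>

lemma average_Linf:
  fixes D :: "'e set"
  assumes N: "N \<in> null_sets M"
    and D: "\<And>X :: 'e set. open X \<Longrightarrow> X \<noteq> {} \<Longrightarrow> \<exists>d\<in>D. d \<in> X"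
    and borel: "\<And>\<sigma> v. \<sigma> \<in> {..<n} \<rightarrow>\<^sub>E UNIV \<Longrightarrow> v \<in> D \<Longrightarrow>
      (\<lambda>x. if x \<in> N then 0 else m x (slice n a x (sections n \<sigma> x) v)) \<in> borel_measurable M"
  shows "average n N a \<in> Linf_wstar (\<G> n)"
proof -
  have comp: "(\<lambda>f. f i) \<in> measurable (\<G> n) (rel_space M R)" if "i < n" for i
    using that unfolding measurable_cong_sets[OF sets_\<G> refl]
    by (intro measurable_restrict_space1 measurable_component_singleton) simp
  have fst0: "(\<lambda>f. fst (f 0)) \<in> measurable (\<G> n) M"
    using comp[OF n] by (rule measurable_compose) measurable
  have base: "fst (f 0) \<in> space M" "f \<in> fibre_tuples (fst (f 0)) n" if "f \<in> space (\<G> n)" for f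
  proof -
    show *: "f \<in> fibre_tuples (fst (f 0)) n"
      using that tuples_eq[OF n] by (simp add: space_\<G>)
    show "fst (f 0) \<in> space M"
      using R_sub[OF R_of_fibre_tuples[OF * n]] by simp
  qed
  have "(\<lambda>f. average n N a f v) \<in> borel_measurable (\<G> n)" if v: "v \<in> D" for v
  proof -
    define A where "A \<sigma> = {f \<in> space (\<G> n). \<forall>i\<in>{..<n}. snd (f i) = s (\<sigma> i) (fst (f 0))}" for \<sigma>
    have A: "A \<sigma> \<in> sets (\<G> n)" for \<sigma>
    proof -
      have "Measurable.pred (\<G> n) (\<lambda>f. snd (f i) = s (\<sigma> i) (fst (f 0)))" if "i \<in> {..<n}" for i
        using measurable_compose[OF comp measurable_snd_rel, of i]
          measurable_compose[OF fst0 s_measurable] that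
        by (intro pred_eq) auto
      then show ?thesis
        unfolding A_def pred_def[symmetric] by (intro pred_intros_finite) auto
    qed
    show ?thesis
    proof (rule measurable_piecewise_restrict[where C = "A ` ({..<n} \<rightarrow>\<^sub>E UNIV)"])
      show "countable (A ` ({..<n} \<rightarrow>\<^sub>E UNIV))"
        by (intro countable_image countable_PiE) auto
      show "space (\<G> n) \<subseteq> \<Union> (A ` ({..<n} \<rightarrow>\<^sub>E UNIV))"
      proof
        fix f assume f: "f \<in> space (\<G> n)"
        from ex_sections[OF base(2)[OF f]] obtain \<sigma> where
          "\<sigma> \<in> {..<n} \<rightarrow>\<^sub>E UNIV" "\<forall>i<n. snd (f i) = s (\<sigma> i) (fst (f 0))" ..
        with f show "f \<in> \<Union> (A ` ({..<n} \<rightarrow>\<^sub>E UNIV))"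
          by (auto simp: A_def)
      qed
      fix \<Omega> assume "\<Omega> \<in> A ` ({..<n} \<rightarrow>\<^sub>E UNIV)"
      then obtain \<sigma> where \<sigma>: "\<Omega> = A \<sigma>" "\<sigma> \<in> {..<n} \<rightarrow>\<^sub>E UNIV"
        by (rule imageE)
      show "\<Omega> \<inter> space (\<G> n) \<in> sets (\<G> n)"
        unfolding \<sigma>(1) by (intro sets.Int A sets.top)
      let ?F = "\<lambda>x. if x \<in> N then 0 else m x (slice n a x (sections n \<sigma> x) v)"
      have "(\<lambda>f. ?F (fst (f 0))) \<in> borel_measurable (restrict_space (\<G> n) \<Omega>)"
        by (intro measurable_restrict_space1 measurable_compose[OF fst0] borel \<sigma>(2) v)
      moreover have "average n N a f v = ?F (fst (f 0))" if "f \<in> space (restrict_space (\<G> n) \<Omega>)" for f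
      proof (cases "fst (f 0) \<in> N")
        case False
        have f: "f \<in> space (\<G> n)" "\<forall>i\<in>{..<n}. snd (f i) = s (\<sigma> i) (fst (f 0))"
          using that by (auto simp: space_restrict_space \<sigma>(1) A_def)
        have "f = sections n \<sigma> (fst (f 0))"
          using f(2) by (intro eq_sections base(2) f(1)) auto
        with False show ?thesis
          using average_apply[OF base(1)[OF f(1)] False base(2)[OF f(1)]] by simp
      qed (simp add: average_def)
      ultimately show "(\<lambda>f. average n N a f v) \<in> borel_measurable (restrict_space (\<G> n) \<Omega>)"
        by (subst measurable_cong) assumption+
    qed
  qed
  then have "(\<lambda>f. average n N a f v) \<in> borel_measurable (\<G> n)" for v
    using D by (rule blinfun_measurable_dense[rotated])
  moreover have "AE f in \<G> n. norm (average n N a f) \<le> C"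
  proof (rule AE_fibre_tuplesI[OF n])
    have "AE x in M. x \<notin> N"
      using N by (rule AE_not_in)
    then show "AE x in M. \<forall>f\<in>fibre_tuples x n. norm (average n N a f) \<le> C"
      using AE_space by eventually_elim (use norm_average in blast)
  qed
  ultimately show ?thesis
    unfolding Linf_wstar_def by blast
qed

text \<open>Put \<open>g = f 0 = (x, y)\<close>. Invariance of the means moves the slice over
  \<open>x\<close> to its translate over \<open>y\<close>, and invariance of \<open>a\<close>
  identifies that translate with the slice at the translated tuple. Both \<open>x\<close> and
  \<open>y\<close> must avoid \<open>N\<close>, so that both averages are given by means.\<close>

lemma average_translated:
  assumes x: "x \<in> space M" "x \<notin> N" and f: "f \<in> fibre_tuples x (Suc n)" and y: "snd (f 0) \<notin> N"
    and inv_a: "\<And>f. f \<in> fibre_tuples x (Suc (Suc n)) \<Longrightarrow>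
      a (translated_tail (Suc n) f) = a (tail_tuple (Suc n) f)"
    and inv_m: "\<And>g \<phi>. g \<in> R \<Longrightarrow> fst g = x \<Longrightarrow> \<phi> \<in> bounded_borel (rel_space M R) \<Longrightarrow>
      m (fst g) (fibre_restrict (fst g) \<phi>) = m (snd g) (inv_translate g (fibre_restrict (fst g) \<phi>))"
  shows "average n N a (translated_tail n f) = average n N a (tail_tuple n f)"
proof (rule blinfun_eqI)
  fix v
  let ?\<phi> = "slice n a x (tail_tuple n f) v"
  define y where "y = snd (f 0)"
  have f0: "f 0 = (x, y)" "(x, y) \<in> R"
    using fibre_tuples_fst[OF f] R_of_fibre_tuples[OF f] by (simp_all add: y_def prod_eq_iff)
  have yM: "y \<in> space M" "y \<notin> N"
    using R_sub[OF f0(2)] y by (simp_all add: y_def)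
  have tail: "tail_tuple n f \<in> fibre_tuples x n"
    by (rule tail_fibre_tuples) (rule f)
  have trans: "translated_tail n f \<in> fibre_tuples y n"
    using translated_fibre_tuples[OF f] by (simp add: y_def)
  have \<phi>_bound: "\<bar>?\<phi> h\<bar> \<le> C * norm v" for h
    using bound[OF x] C0 tail by (rule slice_bound)
  have restr: "fibre_restrict x ?\<phi> = ?\<phi>"
    by (auto simp: fibre_restrict_def slice_def)
  have "?\<phi> \<in> bounded_borel (rel_space M R)"
    using slice_measurable \<phi>_bound unfolding bounded_borel_def by blast
  from inv_m[OF f0(2) _ this] have m_eq: "m x ?\<phi> = m y (inv_translate (x, y) ?\<phi>)"
    by (simp add: restr)
  have eq: "inv_translate (x, y) ?\<phi> h = slice n a y (translated_tail n f) v h" if h: "h \<in> R" for h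
  proof (cases "fst h = y")
    case True
    define w where "w = snd h"
    have hw: "h = (y, w)"
      using True by (simp add: w_def prod_eq_iff)
    have xw: "(x, w) \<in> R"
      using f0(2) h unfolding hw by (rule R_trans)
    let ?f = "cons_tuple n (x, w) (tail_tuple n f)"
    have f1: "?f \<in> fibre_tuples x (Suc n)"
      using xw by (intro cons_fibre_tuples[OF tail]) auto
    \<comment> \<open>Invariance of \<open>a\<close> is applied with \<open>f 0\<close> as the
      translating element and \<open>(x, w)\<close> inserted as the variable of integration.\<close>
    have "cons_tuple (Suc n) (f 0) ?f \<in> fibre_tuples x (Suc (Suc n))"
      using f0 by (intro cons_fibre_tuples[OF f1]) auto
    from inv_a[OF this] have "a (cons_tuple n (y, w) (translated_tail n f)) = a ?f"
      using cons_translated_tail[of f x n w] f0(1) tail_cons_tuple[OF fibre_tuples_extensional[OF f1]]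
      by simp
    with xw h show ?thesis
      by (simp add: inv_translate_def gmult_def slice_def hw)
  qed (simp add: inv_translate_def slice_def)
  have eb: "slice n a y (translated_tail n f) v \<in> ess_bounded (\<kappa> y)"
    using bound[OF yM] C0 trans yM(1) by (rule slice_ess_bounded)
  have "inv_translate (x, y) ?\<phi> \<in> borel_measurable (rel_space M R)"
    by (rule measurable_fibre_function[of y]) (simp add: inv_translate_def)
  then have "inv_translate (x, y) ?\<phi> \<in> borel_measurable (\<kappa> y)"
    by (simp add: measurable_cong_sets[OF sets_\<kappa>[OF yM(1)] refl])
  moreover have "\<bar>inv_translate (x, y) ?\<phi> h\<bar> \<le> C * norm v" for h
    using \<phi>_bound C0 by (simp add: inv_translate_def)
  ultimately have "inv_translate (x, y) ?\<phi> \<in> ess_bounded (\<kappa> y)"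
    by (intro ess_boundedI[of _ _ "C * norm v"]) auto
  then have "m y (inv_translate (x, y) ?\<phi>) = m y (slice n a y (translated_tail n f) v)"
    using eb eq by (intro mean_cong[OF mean[OF yM(1)]] AE_I2) (auto simp: space_\<kappa> yM)
  then show "average n N a (translated_tail n f) v = average n N a (tail_tuple n f) v"
    unfolding average_apply[OF x tail] average_apply[OF yM trans] m_eq by simp
qed

text \<open>The cocycle identity at \<open>cons_tuple (Suc n) h f\<close> expresses
  \<open>a f\<close>, which is constant in \<open>h\<close>, through slices; the mean of a constant
  is the constant. For \<open>n = Suc k\<close> the right-hand side is \<open>coboundary k\<close>
  of the average.\<close>

lemma average_coboundary:
  assumes x: "x \<in> space M" "x \<notin> N" and f: "f \<in> fibre_tuples x (Suc n)"
    and conc: "AE g in \<kappa> x. fst g = x"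
    and cocycle: "\<And>f. f \<in> fibre_tuples x (Suc (Suc n)) \<Longrightarrow> coboundary n a f = 0"
  shows "a f = (\<Sum>i<Suc n. (- 1) ^ i *\<^sub>R average n N a (omit n i f))"
proof (rule blinfun_eqI)
  fix v
  have mx: "is_mean (\<kappa> x) (m x)"
    by (rule mean) fact
  have om: "omit n i f \<in> fibre_tuples x n" for i
    by (rule omit_fibre_tuples) (rule f)
  have eb: "slice n a x (omit n i f) v \<in> ess_bounded (\<kappa> x)" for i
    using bound[OF x] C0 om x(1) by (rule slice_ess_bounded)
  have eq: "(\<Sum>i<Suc n. (- 1) ^ i * slice n a x (omit n i f) v h) = a f v" if h: "h \<in> R" "fst h = x" for h
  proof -
    let ?f = "cons_tuple (Suc n) h f"
    have "?f \<in> fibre_tuples x (Suc (Suc n))"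
      using f h by (rule cons_fibre_tuples)
    then have "0 = coboundary n a ?f"
      using cocycle by simp
    \<comment> \<open>The term that drops \<open>h\<close> is split off; in the others the index,
      and with it the sign, shifts by one.\<close>
    also have "\<dots> = a (omit (Suc n) 0 ?f) + (\<Sum>i<Suc n. (- 1) ^ Suc i *\<^sub>R a (omit (Suc n) (Suc i) ?f))"
      unfolding coboundary_def by (subst sum.lessThan_Suc_shift) simp
    also have "\<dots> = a f - (\<Sum>i<Suc n. (- 1) ^ i *\<^sub>R a (cons_tuple n h (omit n i f)))"
      using omit_0_cons_tuple[OF fibre_tuples_extensional[OF f]]
      by (simp add: omit_Suc_cons_tuple sum_negf del: sum.lessThan_Suc)
    finally have "a f = (\<Sum>i<Suc n. (- 1) ^ i *\<^sub>R a (cons_tuple n h (omit n i f)))"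
      by simp
    then show ?thesis
      using h by (simp add: slice_def blinfun.sum_left blinfun.scaleR_left del: sum.lessThan_Suc)
  qed
  \<comment> \<open>The slices vanish off the fibre over \<open>x\<close>, so the identity holds on
    that fibre only; concentration of \<open>\<kappa> x\<close> makes this enough.\<close>
  have "AE h in \<kappa> x. (\<Sum>i<Suc n. (- 1) ^ i * slice n a x (omit n i f) v h) = a f v"
    using conc AE_space by eventually_elim (use eq x(1) in \<open>auto simp: space_\<kappa>\<close>)
  moreover have "(\<lambda>h. \<Sum>i<Suc n. (- 1) ^ i * slice n a x (omit n i f) v h) \<in> ess_bounded (\<kappa> x)"
    by (intro ess_bounded_sum ess_bounded_cmult eb) simp
  ultimately have "m x (\<lambda>h. \<Sum>i<Suc n. (- 1) ^ i * slice n a x (omit n i f) v h) = m x (\<lambda>_. a f v)"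
    by (intro mean_cong[OF mx]) auto
  then have "a f v = (\<Sum>i<Suc n. (- 1) ^ i * m x (slice n a x (omit n i f) v))"
    by (simp only: mean_sum[OF mx finite_lessThan eb] mean_const[OF mx])
  then show "a f v = (\<Sum>i<Suc n. (- 1) ^ i *\<^sub>R average n N a (omit n i f)) v"
    using average_apply[OF x om]
    by (simp add: blinfun.sum_left blinfun.scaleR_left del: sum.lessThan_Suc)
qed

end

lemma cocycles_subset_coboundaries:
  "cocycles \<G> (Suc k) \<subseteq>
    (coboundaries \<G> (Suc k) ::
      ((nat \<Rightarrow> 'a \<times> 'a) \<Rightarrow> ('e::{real_normed_vector, second_countable_topology} \<Rightarrow>\<^sub>L real)) set)"
proof
  fix a :: "(nat \<Rightarrow> 'a \<times> 'a) \<Rightarrow> ('e \<Rightarrow>\<^sub>L real)"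
  assume "a \<in> cocycles \<G> (Suc k)"
  then have a: "a \<in> inv_cochains \<G> (Suc k)" "a \<in> Linf_wstar (\<G> (Suc (Suc k)))"
      "AE f in \<G> (Suc (Suc (Suc k))). a (translated_tail (Suc (Suc k)) f) = a (tail_tuple (Suc (Suc k)) f)"
      "AE f in \<G> (Suc (Suc (Suc k))). coboundary (Suc k) a f = 0"
    by (simp_all add: cocycles_def inv_cochains_def)
  obtain C0 where C0: "AE f in \<G> (Suc (Suc k)). norm (a f) \<le> C0"
    using a(2) unfolding Linf_wstar_def by blast
  \<comment> \<open>The bound has to be nonnegative because it must also hold where slices are
    extended by zero.\<close>
  define C where "C = max 0 C0"
  have C: "0 \<le> C" "AE f in \<G> (Suc (Suc k)). norm (a f) \<le> C"
    using C0 by (auto simp: C_def le_max_iff_disj)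
  obtain N0 where N0: "{x \<in> space M. \<not> (\<forall>f\<in>fibre_tuples x (Suc (Suc k)). norm (a f) \<le> C)} \<subseteq> N0"
      "emeasure M N0 = 0" "N0 \<in> sets M"
    using AE_E[OF AE_fibre_tuplesD[OF C(2)]] .
  have bound0: "norm (a f) \<le> C" if "x \<in> space M" "x \<notin> N0" "f \<in> fibre_tuples x (Suc (Suc k))" for x f
    using N0(1) that by blast
  obtain D :: "'e set" where D: "countable D" "\<And>X :: 'e set. open X \<Longrightarrow> X \<noteq> {} \<Longrightarrow> \<exists>d\<in>D. d \<in> X"
    using countable_dense_exists[where 'a = 'e] by blast
  \<comment> \<open>The null set is chosen in two stages: off \<open>N0\<close> the cocycle is
    bounded, which makes each \<open>F i\<close> measurable for the completion; off the larger null
    set \<open>N\<close> all \<open>F i\<close> with \<open>i \<in> I\<close> are also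
    Borel.\<close>
  define F where "F = (\<lambda>(\<sigma>, v) x. if x \<in> N0 then 0 else m x (slice (Suc k) a x (sections (Suc k) \<sigma> x) v))"
  define I where "I = ({..<Suc k} \<rightarrow>\<^sub>E (UNIV :: nat set)) \<times> D"
  have "countable I"
    unfolding I_def using D(1) by (intro countable_SIGMA countable_PiE) auto
  moreover have "F i \<in> borel_measurable (completion M)" for i
  proof -
    have "(\<lambda>f. a f v) \<in> borel_measurable (\<G> (Suc (Suc k)))" for v
      using a(2) unfolding Linf_wstar_def by blast
    then show ?thesis
      unfolding F_def split_def using N0(3) bound0 C(1) by (rule slice_mean_measurable)
  qed
  moreover have "AE x in M. x \<notin> N0"
    using N0 by (intro AE_not_in) auto
  ultimately obtain N where N: "N \<in> null_sets M" "\<And>x. x \<in> space M \<Longrightarrow> x \<notin> N \<Longrightarrow> x \<notin> N0"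
      "\<And>i. i \<in> I \<Longrightarrow> (\<lambda>x. if x \<in> N then 0 else F i x) \<in> borel_measurable M"
    using null_set_borel_versions[of I F M "\<lambda>x. x \<notin> N0"] by blast
  have bounded: "\<forall>x\<in>space M - N. \<forall>f\<in>fibre_tuples x (Suc (Suc k)). norm (a f) \<le> C"
    using bound0 N(2) by blast
  note average = zero_less_Suc[of k] C(1) bounded
  define b where "b = average (Suc k) N a"
  have "b \<in> Linf_wstar (\<G> (Suc k))"
    unfolding b_def
  proof (rule average_Linf[OF average N(1) D(2)])
    fix \<sigma> v assume "\<sigma> \<in> {..<Suc k} \<rightarrow>\<^sub>E (UNIV :: nat set)" "v \<in> D"
    then have "(\<lambda>x. if x \<in> N then 0 else F (\<sigma>, v) x) \<in> borel_measurable M"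
      by (intro N(3)) (auto simp: I_def)
    \<comment> \<open>Off \<open>N\<close> the base point also avoids \<open>N0\<close>, so the
      inner case distinction of \<open>F\<close> disappears.\<close>
    also have "?this \<longleftrightarrow> (\<lambda>x. if x \<in> N then 0 else m x (slice (Suc k) a x (sections (Suc k) \<sigma> x) v))
        \<in> borel_measurable M"
      using N(2) by (intro measurable_cong) (simp add: F_def)
    finally show "(\<lambda>x. if x \<in> N then 0 else m x (slice (Suc k) a x (sections (Suc k) \<sigma> x) v))
        \<in> borel_measurable M" .
  qed
  moreover have N_ae: "AE x in M. x \<notin> N"
    using N(1) by (rule AE_not_in)
  have "AE f in \<G> (Suc (Suc k)). b (translated_tail (Suc k) f) = b (tail_tuple (Suc k) f)"
  proof (rule AE_fibre_tuplesI)
    show "AE x in M. \<forall>f\<in>fibre_tuples x (Suc (Suc k)).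
        b (translated_tail (Suc k) f) = b (tail_tuple (Suc k) f)"
      \<comment> \<open>Almost every \<open>x\<close> has its whole class outside \<open>N\<close>,
        so the source of \<open>f 0\<close> is a good base point too.\<close>
      using N_ae AE_class[OF N_ae] AE_target[OF mean_invariant] AE_fibre_tuplesD[OF a(3)] AE_space
    proof eventually_elim
      case (elim x)
      show ?case
      proof
        fix f assume f: "f \<in> fibre_tuples x (Suc (Suc k))"
        have "snd (f 0) \<notin> N"
          using elim(2) R_of_fibre_tuples[OF f, of 0] by simp
        then show "b (translated_tail (Suc k) f) = b (tail_tuple (Suc k) f)"
          unfolding b_def using elim(3,4)
          by (intro average_translated[OF average elim(5,1) f]) auto
      qed
    qed
  qed simp
  ultimately have "b \<in> inv_cochains \<G> k"
    by (simp add: inv_cochains_def)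
  moreover have "AE f in \<G> (Suc (Suc k)). a f = coboundary k b f"
  proof (rule AE_fibre_tuplesI)
    show "AE x in M. \<forall>f\<in>fibre_tuples x (Suc (Suc k)). a f = coboundary k b f"
      using N_ae AE_\<kappa>_concentrated AE_fibre_tuplesD[OF a(4)] AE_space
    proof eventually_elim
      case (elim x)
      then show ?case
        unfolding b_def coboundary_def[of k]
        by (intro ballI average_coboundary[OF average elim(4,1)]) auto
    qed
  qed simp
  ultimately show "a \<in> coboundaries \<G> (Suc k)"
    using a(1) by auto
qed

end

section \<open>The cohomology group as a quotient\<close>

text \<open>The scalar \<open>c\<close> treats sums (\<open>c = 1\<close>) and differences
  (\<open>c = - 1\<close>) at once.\<close>

lemma inv_cochains_lin:
  assumes "a \<in> inv_cochains G k" "b \<in> inv_cochains G k"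
  shows "(\<lambda>f. a f + c *\<^sub>R b f) \<in> inv_cochains G k"
proof -
  obtain C D where CD: "AE f in G (Suc k). norm (a f) \<le> C" "AE f in G (Suc k). norm (b f) \<le> D"
    using assms unfolding inv_cochains_def Linf_wstar_def by blast
  have "AE f in G (Suc k). norm (a f + c *\<^sub>R b f) \<le> C + \<bar>c\<bar> * D"
    using CD
  proof eventually_elim
    case (elim f)
    have "norm (a f + c *\<^sub>R b f) \<le> norm (a f) + \<bar>c\<bar> * norm (b f)"
      using norm_triangle_ineq[of "a f" "c *\<^sub>R b f"] by simp
    also have "\<dots> \<le> C + \<bar>c\<bar> * D"
      using elim by (intro add_mono mult_left_mono) auto
    finally show ?case .
  qed
  moreover have "(\<lambda>f. blinfun_apply (a f + c *\<^sub>R b f) v) \<in> borel_measurable (G (Suc k))" for v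
  proof -
    have "(\<lambda>f. blinfun_apply (a f) v) \<in> borel_measurable (G (Suc k))"
        "(\<lambda>f. blinfun_apply (b f) v) \<in> borel_measurable (G (Suc k))"
      using assms unfolding inv_cochains_def Linf_wstar_def by blast+
    then show ?thesis
      by (simp add: blinfun.add_left blinfun.scaleR_left)
  qed
  moreover have "AE f in G (Suc (Suc k)).
      a (translated_tail (Suc k) f) + c *\<^sub>R b (translated_tail (Suc k) f) =
      a (tail_tuple (Suc k) f) + c *\<^sub>R b (tail_tuple (Suc k) f)"
  proof -
    have "AE f in G (Suc (Suc k)). a (translated_tail (Suc k) f) = a (tail_tuple (Suc k) f)"
        "AE f in G (Suc (Suc k)). b (translated_tail (Suc k) f) = b (tail_tuple (Suc k) f)"
      using assms unfolding inv_cochains_def by blast+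
    then show ?thesis
      by eventually_elim simp
  qed
  ultimately show ?thesis
    unfolding inv_cochains_def Linf_wstar_def by blast
qed

lemma coboundary_lin:
  "coboundary k (\<lambda>f. a f + c *\<^sub>R b f) f = coboundary k a f + c *\<^sub>R coboundary k b f"
  by (simp add: coboundary_def scaleR_add_right sum.distrib scaleR_sum_right mult.commute
      del: sum.lessThan_Suc)

lemma zero_inv_cochain: "(\<lambda>_. 0) \<in> inv_cochains G k"
  by (auto simp: inv_cochains_def Linf_wstar_def intro: exI[of _ 0])

lemma zero_cocycle: "(\<lambda>_. 0) \<in> cocycles G k"
  by (simp add: cocycles_def zero_inv_cochain coboundary_def)

lemma coboundaries_lin:
  assumes "a \<in> coboundaries G (Suc k)" "b \<in> coboundaries G (Suc k)"
  shows "(\<lambda>f. a f + c *\<^sub>R b f) \<in> coboundaries G (Suc k)"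
proof -
  obtain a' b' where *: "a' \<in> inv_cochains G k" "AE f in G (Suc (Suc k)). a f = coboundary k a' f"
      "b' \<in> inv_cochains G k" "AE f in G (Suc (Suc k)). b f = coboundary k b' f"
    using assms by auto
  have "AE f in G (Suc (Suc k)). a f + c *\<^sub>R b f = coboundary k (\<lambda>f. a' f + c *\<^sub>R b' f) f"
    using *(2,4) by eventually_elim (simp add: coboundary_lin)
  moreover have "(\<lambda>f. a' f + c *\<^sub>R b' f) \<in> inv_cochains G k"
    using *(1,3) by (rule inv_cochains_lin)
  moreover have "(\<lambda>f. a f + c *\<^sub>R b f) \<in> inv_cochains G (Suc k)"
    using assms by (intro inv_cochains_lin) auto
  ultimately show ?thesis
    by auto
qed

text \<open>All cosets coincide with \<open>H\<close>, so the group laws of the quotient are checked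
  directly on its single element.\<close>

lemma trivial_group_Mod:
  fixes K :: "('c, 'd) monoid_scheme"
  assumes "x \<in> carrier K" and "\<And>x. x \<in> carrier K \<Longrightarrow> H #>\<^bsub>K\<^esub> x = H" and "H <#>\<^bsub>K\<^esub> H = H"
  shows "trivial_group (K Mod H)"
proof -
  have "carrier (K Mod H) = {H}"
    using assms(1,2) by (auto simp: FactGroup_def RCOSETS_def)
  moreover have "group (K Mod H)"
    by (rule groupI) (use assms(3) \<open>carrier (K Mod H) = {H}\<close> in \<open>auto simp: FactGroup_def\<close>)
  ultimately show ?thesis
    by (simp add: trivial_group_def FactGroup_def)
qed

lemma trivial_cohomology:
  fixes G :: "nat \<Rightarrow> (nat \<Rightarrow> 'a \<times> 'a) measure"
  assumes "cocycles G (Suc k) \<subseteq>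
    (coboundaries G (Suc k) :: ((nat \<Rightarrow> 'a \<times> 'a) \<Rightarrow> ('e::real_normed_vector \<Rightarrow>\<^sub>L real)) set)"
  shows "trivial_group (cocycle_group G (Suc k) Mod
    (coboundaries G (Suc k) :: ((nat \<Rightarrow> 'a \<times> 'a) \<Rightarrow> ('e \<Rightarrow>\<^sub>L real)) set))"
proof (rule trivial_group_Mod)
  let ?K = "cocycle_group G (Suc k) :: ((nat \<Rightarrow> 'a \<times> 'a) \<Rightarrow> ('e \<Rightarrow>\<^sub>L real)) monoid"
  let ?H = "coboundaries G (Suc k) :: ((nat \<Rightarrow> 'a \<times> 'a) \<Rightarrow> ('e \<Rightarrow>\<^sub>L real)) set"
  show "(\<lambda>_. 0) \<in> carrier ?K"
    by (simp add: cocycle_group_def zero_cocycle)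
  have zero: "(\<lambda>_. 0) \<in> ?H"
    using assms zero_cocycle by blast
  have add: "(\<lambda>f. a f + b f) \<in> ?H" if "a \<in> ?H" "b \<in> ?H" for a b
    using coboundaries_lin[OF that, of 1] by simp
  have diff: "(\<lambda>f. a f - b f) \<in> ?H" if "a \<in> ?H" "b \<in> ?H" for a b
    using coboundaries_lin[OF that, of "- 1"] by simp
  have mult: "mult ?K = (\<lambda>a b f. a f + b f)"
    by (simp add: cocycle_group_def)
  show "?H #>\<^bsub>?K\<^esub> a = ?H" if "a \<in> carrier ?K" for a
  proof -
    have a: "a \<in> ?H"
      using that assms by (auto simp: cocycle_group_def)
    \<comment> \<open>Every cocycle \<open>a\<close> is a coboundary, so
      \<open>h = (h - a) + a\<close> exhibits \<open>h\<close> in the coset of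
      \<open>a\<close>.\<close>
    have "h \<in> ?H #>\<^bsub>?K\<^esub> a" if "h \<in> ?H" for h
      unfolding r_coset_def mult by (rule UN_I[OF diff[OF that a]]) simp
    then show ?thesis
      using add a unfolding r_coset_def mult by blast
  qed
  have "h \<in> ?H <#>\<^bsub>?K\<^esub> ?H" if "h \<in> ?H" for h
    unfolding set_mult_def mult by (rule UN_I[OF that], rule UN_I[OF zero]) simp
  then show "?H <#>\<^bsub>?K\<^esub> ?H = ?H"
    using add unfolding set_mult_def mult by blast
qed

section \<open>From the group action to the theorem\<close>

lemma orbit_sections:
  fixes G :: "nat monoid"
  assumes G: "group G" and \<phi>: "class_preserving_action G M \<phi>"
  obtains s :: "nat \<Rightarrow> 'a \<Rightarrow> 'a" where "\<And>n. s n \<in> measurable M M"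
    "\<And>x y. y \<in> orbit G \<phi> x \<longleftrightarrow> (\<exists>n. y = s n x)"
proof
  \<comment> \<open>The group elements are themselves natural numbers. Indices outside the carrier
    are sent to the identity, which keeps every map Borel and adds no point to any orbit.\<close>
  let ?s = "\<lambda>n. \<phi> (if n \<in> carrier G then n else \<one>\<^bsub>G\<^esub>)"
  have one: "\<one>\<^bsub>G\<^esub> \<in> carrier G"
    using G by (simp add: group.is_monoid monoid.one_closed)
  then show "?s n \<in> measurable M M" for n
    using \<phi> by (simp add: class_preserving_action_def)
  show "y \<in> orbit G \<phi> x \<longleftrightarrow> (\<exists>n. y = ?s n x)" for x y
    using one by (auto simp: orbit_def)
qed

theorem proposition6p7:
  fixes M :: "'a measure" and R :: "('a \<times> 'a) set"
    and \<nu> :: "('a \<times> 'a) measure" and \<kappa> :: "'a \<Rightarrow> ('a \<times> 'a) measure" and k :: nat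
  assumes "II1_relation M R"
    and "symmetric_class_prob M R \<nu>"
    and "target_disintegration M R \<nu> \<kappa>"
    and "amenable M R \<nu> \<kappa>"
    and "k \<ge> 1"
  shows "trivial_group (Hmb M R \<nu> \<kappa> k ::
    ((nat \<Rightarrow> 'a \<times> 'a) \<Rightarrow> ('e::{banach, second_countable_topology} \<Rightarrow>\<^sub>L real)) set monoid)"
proof -
  obtain G :: "nat monoid" and \<phi> where G: "group G" "class_preserving_action G M \<phi>"
      and R: "R = {(x, y). x \<in> space M \<and> y \<in> orbit G \<phi> x}"
    using assms(1) unfolding II1_relation_def by blast
  have R': "prob_space M" "standard_borel_space M" "R \<in> sets (M \<Otimes>\<^sub>M M)" "equiv (space M) R"
    using assms(1) by (simp_all add: II1_relation_def)
  obtain s :: "nat \<Rightarrow> 'a \<Rightarrow> 'a" where s: "\<And>n. s n \<in> measurable M M" "\<And>x y. y \<in> orbit G \<phi> x \<longleftrightarrow> (\<exists>n. y = s n x)"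
    by (rule orbit_sections[OF G(1) G(2)]) (erule that, assumption)
  obtain m where m: "\<forall>x\<in>space M. is_mean (\<kappa> x) (m x)"
      "\<forall>f\<in>bounded_borel (rel_space M R).
         (\<lambda>x. m x (fibre_restrict x f)) \<in> borel_measurable (completion M)"
      "AE g in \<nu>. \<forall>f\<in>bounded_borel (rel_space M R).
         m (fst g) (fibre_restrict (fst g) f) =
         m (snd g) (inv_translate g (fibre_restrict (fst g) f))"
    using assms(4) unfolding amenable_def by (elim exE conjE)
  have "countable_measured_relation M R \<nu> \<kappa> s"
    by (intro countable_measured_relation.intro countable_measured_relation_axioms.intro
        R' standard_borel_space_diagonal assms(2,3) s(1)) (simp add: R s(2))
  then interpret amenable_measured_relation M R \<nu> \<kappa> s m
    by (intro amenable_measured_relation.intro amenable_measured_relation_axioms.intro m(3))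
      (use m(1,2) in blast)+
  obtain j where "k = Suc j"
    using assms(5) by (cases k) auto
  then show ?thesis
    unfolding Hmb_def by (simp only: trivial_cohomology[OF cocycles_subset_coboundaries])
qed

end
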